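(* Let $A$ and $B$ be real matrices of size $n\times n$ and $n\times m$ respectively. Assume that the pair $(A,B)$ is stabilizable and that the matrix $A$ is neutrally stable. Then there exists a real matrix $K$ of size $m\times n$ such that, for every $0<\mu\leq T$, the gain $K$ is a $(T,\mu)$-stabilizer for the system $\dot x=Ax+\alpha(t)Bu$.
   Context: A matrix is neutrally stable if all its eigenvalues have non-positive real part and those with zero real part have trivial corresponding Jordan blocks. For positive constants $\mu\leq T$, a $(T,\mu)$-signal is a measurable function $\alpha:\mathbb{R}_{\geq 0}\to[0,1]$ such that $\int_t^{t+T}\alpha(s)\,ds\geq\mu$ for every $t\geq 0$; $\mathcal{G}(T,\mu)$ denotes the set of all $(T,\mu)$-signals. For $t_0\ge 0$, $x_0\in\mathbb{R}^n$, $x(\cdot\,;t_0,x_0,K,\alpha)$ denotes the solution of $\dot x=(A+\alpha(t)BK)x$ with $x(t_0)=x_0$. A function $\beta:\mathbb{R}_{\geq 0}\times\mathbb{R}_{\geq 0}\to\mathbb{R}_{\geq 0}$ is of class $\mathcal{KL}$ if $\beta(\cdot,t)$ is continuous, strictly increasing and vanishes at $0$ for every $t\ge0$, and $\beta(s,\cdot)$ is continuous, non-increasing and tends to zero at infinity for every $s\ge 0$. The gain $K$ is a $(T,\mu)$-stabilizer for $\dot x=Ax+\alpha(t)Bu$ if there exists a class $\mathcal{KL}$ function $\beta$ such that, for every $\alpha\in\mathcal{G}(T,\mu)$, $x_0\in\mathbb{R}^n$ and $t_0\geq 0$, one has $|x(t;t_0,x_0,K,\alpha)|\leq\beta(|x_0|,t-t_0)$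 for all $t\geq t_0$, where $|\cdot|$ is the Euclidean norm. *)

theory Defs
  imports
    "HOL-Analysis.Analysis"
    "Jordan_Normal_Form.Jordan_Normal_Form"
begin

(* Spectral notions are taken over the complex numbers from Jordan_Normal_Form, whose matrices
   are indexed by natural numbers. The enumeration of the index type is an arbitrary choice;
   another one conjugates the matrix by a permutation, which affects neither the eigenvalues
   nor the Jordan normal form. *)

definition index_enum :: "nat \<Rightarrow> 'n::finite" where
  "index_enum = (SOME f. bij_betw f {..<CARD('n)} UNIV)"

lemma bij_betw_index_enum: "bij_betw (index_enum :: nat \<Rightarrow> 'n::finite) {..<CARD('n)} UNIV"
proof -
  have "\<exists>f :: nat \<Rightarrow> 'n. bij_betw f {..<CARD('n)} UNIV"
    using ex_bij_betw_nat_finite[of "UNIV :: 'n set"] by (simp add: atLeast0LessThan)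
  then show ?thesis
    unfolding index_enum_def by (rule someI_ex)
qed

definition complex_mat :: "real ^ 'n ^ 'n \<Rightarrow> complex mat" where
  "complex_mat A = Matrix.mat CARD('n) CARD('n)
     (\<lambda>(i, j). complex_of_real (vec_nth (vec_nth A (index_enum i)) (index_enum j)))"

definition hurwitz :: "real ^ 'n ^ 'n \<Rightarrow> bool" where
  "hurwitz A \<longleftrightarrow> (\<forall>l. eigenvalue (complex_mat A) l \<longrightarrow> Re l < 0)"

definition stabilizable :: "real ^ 'n ^ 'n \<Rightarrow> real ^ 'm ^ 'n \<Rightarrow> bool" where
  "stabilizable A B \<longleftrightarrow> (\<exists>K :: real ^ 'n ^ 'm. hurwitz (A + B ** K))"

(* A pair (k, l) in a list nas with jordan_nf M nas stands for a Jordan block of size k > 0 with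
   eigenvalue l. Over the complex numbers nas exists and is unique up to permutation. *)
definition neutrally_stable :: "real ^ 'n ^ 'n \<Rightarrow> bool" where
  "neutrally_stable A \<longleftrightarrow>
     (\<forall>l. eigenvalue (complex_mat A) l \<longrightarrow> Re l \<le> 0) \<and>
     (\<exists>nas. jordan_nf (complex_mat A) nas \<and> (\<forall>(k, l) \<in> set nas. Re l = 0 \<longrightarrow> k = 1))"

(* Signals and trajectories are total functions on the reals, of which only the values on the
   relevant half-line matter. *)
definition PE_signals :: "real \<Rightarrow> real \<Rightarrow> (real \<Rightarrow> real) set" where
  "PE_signals T \<mu> = {\<alpha>.
     \<alpha> \<in> borel_measurable (lebesgue_on {0..}) \<and>
     (\<forall>t\<ge>0. \<alpha> t \<in> {0..1}) \<and>
     (\<forall>t\<ge>0. (LINT s:{t..t + T}|lebesgue. \<alpha> s) \<ge> \<mu>)}"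

(* As the signal is merely measurable, solutions are understood in the sense of Caratheodory,
   i.e. as continuous solutions of the integral equation. *)
definition is_solution ::
  "real ^ 'n ^ 'n \<Rightarrow> real ^ 'm ^ 'n \<Rightarrow> real ^ 'n ^ 'm \<Rightarrow> (real \<Rightarrow> real) \<Rightarrow> real \<Rightarrow> real ^ 'n
     \<Rightarrow> (real \<Rightarrow> real ^ 'n) \<Rightarrow> bool" where
  "is_solution A B K \<alpha> t0 x0 x \<longleftrightarrow>
     continuous_on {t0..} x \<and>
     (\<forall>t\<ge>t0.
        (\<lambda>s. (A + \<alpha> s *\<^sub>R (B ** K)) *v x s) absolutely_integrable_on {t0..t} \<and>
        x t = x0 + (LINT s:{t0..t}|lebesgue. (A + \<alpha> s *\<^sub>R (B ** K)) *v x s))"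

definition class_KL :: "(real \<Rightarrow> real \<Rightarrow> real) set" where
  "class_KL = {\<beta>.
     (\<forall>s\<ge>0. \<forall>t\<ge>0. \<beta> s t \<ge> 0) \<and>
     (\<forall>t\<ge>0. continuous_on {0..} (\<lambda>s. \<beta> s t) \<and> strict_mono_on {0..} (\<lambda>s. \<beta> s t) \<and> \<beta> 0 t = 0) \<and>
     (\<forall>s\<ge>0. continuous_on {0..} (\<beta> s) \<and> antimono_on {0..} (\<beta> s) \<and> (\<beta> s \<longlongrightarrow> 0) at_top)}"

definition is_stabilizer ::
  "real \<Rightarrow> real \<Rightarrow> real ^ 'n ^ 'n \<Rightarrow> real ^ 'm ^ 'n \<Rightarrow> real ^ 'n ^ 'm \<Rightarrow> bool" where
  "is_stabilizer T \<mu> A B K \<longleftrightarrow>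
     (\<exists>\<beta> \<in> class_KL. \<forall>\<alpha> \<in> PE_signals T \<mu>. \<forall>x0. \<forall>t0\<ge>0. \<forall>x.
        is_solution A B K \<alpha> t0 x0 x \<longrightarrow> (\<forall>t\<ge>t0. norm (x t) \<le> \<beta> (norm x0) (t - t0)))"

end

theory Submission
  imports
    Defs
    "Jordan_Normal_Form.Jordan_Normal_Form_Existence"
    "HOL-Complex_Analysis.Conformal_Mappings"
    "HOL-Real_Asymp.Real_Asymp"
begin

text \<open>
  The Jordan normal form yields \<open>P > 0\<close> with \<open>A\<^sup>T P + P A \<le> 0\<close>, and the gain is \<open>K = - B\<^sup>T P\<close>. As
  \<open>0 \<le> \<alpha> \<le> 1\<close>, the storage \<open>V(x) = x\<^sup>T P x\<close> satisfies \<open>V' \<le> - \<alpha> x\<^sup>T M x\<close> along trajectories, where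
  \<open>M = 2 P B B\<^sup>T P - (A\<^sup>T P + P A) \<ge> 0\<close>. If \<open>V\<close> hardly decreases over a window of length \<open>T\<close>, then the
  trajectory stays close to a trajectory \<open>y\<close> of \<open>y' = A y\<close>. Stabilizability implies that the
  analytic function \<open>M y\<close> does not vanish identically unless \<open>y = 0\<close>; hence it has finitely many
  zeros in the window, and no signal of mass at least \<open>\<mu>\<close> can concentrate on them. Compactness
  of the unit sphere makes the decrease of \<open>V\<close> over a window uniform.
\<close>

section \<open>Quadratic Lyapunov functions from the Jordan normal form\<close>

text \<open>The dissipation of \<open>A\<close> is kept inside \<open>M\<close> because the output
  \<open>transpose B *v (P *v y)\<close> alone may miss part of the state: on modes that decay
  without control it can vanish identically. Where \<open>M y\<close> vanishes, both parts of
  \<open>M\<close> vanish separately, so that any feedback may be added to the costate equation;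
  this spares a splitting of the state space into a decaying and an oscillating part. Since
  \<open>A\<close> dissipates at full rate whatever the signal does, weighting that share by
  \<open>\<alpha> \<le> 1\<close> only weakens the inequality.

  The other obstacle is uniformity over all signals, in general not a norm compact set. The signal
  is removed before compactness is used: with \<open>q\<close> the form of \<open>M\<close> along
  the flow and \<open>g = max 0 (1 - N * q)\<close>, the pointwise bound
  \<open>\<alpha> - g \<le> N * \<alpha> * q\<close> leaves only the integral of \<open>g\<close>,
  which depends on the initial state alone. The gain comes from \<open>A\<close> and
  \<open>B\<close> only, so that one gain serves every \<open>T\<close> and \<open>\<mu>\<close>;
  these enter through the decay rate.\<close>

lemma jordan_matrix_entries:
  fixes \<sigma> :: real
  assumes "\<forall>(k, l) \<in> set nas. Re l \<le> \<sigma> \<and> (1 < k \<longrightarrow> Re l < \<sigma>)"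
    and "i < sum_list (map fst nas)" "j < sum_list (map fst nas)"
  shows "Re (jordan_matrix nas $$ (i, i)) \<le> \<sigma>"
    and "i \<noteq> j \<Longrightarrow> jordan_matrix nas $$ (i, j) \<noteq> 0 \<Longrightarrow>
      j = Suc i \<and> jordan_matrix nas $$ (i, j) = 1 \<and>
      Re (jordan_matrix nas $$ (i, i)) < \<sigma> \<and> Re (jordan_matrix nas $$ (j, j)) < \<sigma>"
proof -
  let ?J = "jordan_matrix"
  have "Re (?J nas $$ (i, i)) \<le> \<sigma> \<and> (i \<noteq> j \<longrightarrow> ?J nas $$ (i, j) \<noteq> 0 \<longrightarrow>
      j = Suc i \<and> ?J nas $$ (i, j) = 1 \<and> Re (?J nas $$ (i, i)) < \<sigma> \<and> Re (?J nas $$ (j, j)) < \<sigma>)"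
    using assms
  proof (induction nas arbitrary: i j)
    case Nil
    then show ?case by simp
  next
    case (Cons na nas)
    obtain k l where na: "na = (k, l)" by force
    let ?s = "sum_list (map fst nas)"
    have l: "Re l \<le> \<sigma>" "1 < k \<Longrightarrow> Re l < \<sigma>"
      using Cons.prems(1) na by auto
    have e: "?J (na # nas) $$ (p, q) = (if p < k then if q < k then jordan_block k l $$ (p, q) else 0
        else if q < k then 0 else ?J nas $$ (p - k, q - k))" if "p < k + ?s" "q < k + ?s" for p q
      using that unfolding na jordan_matrix_Cons by (subst index_mat_four_block) auto
    have ij: "i < k + ?s" "j < k + ?s" using Cons.prems na by auto
    have hyp: "\<forall>(k, l) \<in> set nas. Re l \<le> \<sigma> \<and> (1 < k \<longrightarrow> Re l < \<sigma>)"
      using Cons.prems(1) by simp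
    show ?case
    proof (cases "i < k")
      case True
      then show ?thesis using ij l by (simp add: e)
    next
      case i: False
      then have ik: "i - k < ?s" using ij by simp
      show ?thesis
      proof (cases "j < k")
        case True
        then show ?thesis using ij i Cons.IH[OF hyp ik ik] by (simp add: e)
      next
        case j: False
        then have jk: "j - k < ?s" using ij by simp
        have "j - k = Suc (i - k) \<longleftrightarrow> j = Suc i" "i - k = j - k \<longleftrightarrow> i = j"
          using i j by arith+
        then show ?thesis using ij i j Cons.IH[OF hyp ik jk] by (simp add: e)
      qed
    qed
  qed
  then show "Re (?J nas $$ (i, i)) \<le> \<sigma>"
    and "i \<noteq> j \<Longrightarrow> ?J nas $$ (i, j) \<noteq> 0 \<Longrightarrow> j = Suc i \<and> ?J nas $$ (i, j) = 1 \<and>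
      Re (?J nas $$ (i, i)) < \<sigma> \<and> Re (?J nas $$ (j, j)) < \<sigma>"
    by auto
qed

text \<open>With weights \<open>c ^ i\<close> for a large \<open>c\<close>, Young's inequality absorbs the superdiagonal terms into the
  diagonal ones, which are strict wherever a superdiagonal entry is nonzero.\<close>
lemma bidiagonal_lyapunov:
  fixes J :: "nat \<Rightarrow> nat \<Rightarrow> complex" and \<sigma> :: real
  assumes diag: "\<And>i. i < n \<Longrightarrow> Re (J i i) \<le> \<sigma>"
    and off: "\<And>i j. i < n \<Longrightarrow> j < n \<Longrightarrow> i \<noteq> j \<Longrightarrow> J i j \<noteq> 0 \<Longrightarrow>
      j = Suc i \<and> J i j = 1 \<and> Re (J i i) < \<sigma> \<and> Re (J j j) < \<sigma>"
  obtains c :: real where "c > 0"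
    "\<And>w. (\<Sum>i<n. c ^ i * Re (cnj (w i) * (\<Sum>j<n. J i j * w j)))
      \<le> \<sigma> * (\<Sum>i<n. c ^ i * (cmod (w i))\<^sup>2)"
proof -
  \<comment> \<open>Strict diagonal entries leave a gap of at least \<open>r\<close>; the 1 keeps
    the minimum defined if there are none.\<close>
  define D where "D = insert 1 ((\<lambda>i. \<sigma> - Re (J i i)) ` {i. i < n \<and> Re (J i i) < \<sigma>})"
  define r where "r = Min D"
  have finD: "finite D" "D \<noteq> {}" by (auto simp: D_def)
  have r: "r > 0" using finD by (auto simp: r_def D_def)
  have rle: "r \<le> \<sigma> - Re (J i i)" if "i < n" "Re (J i i) < \<sigma>" for i
    unfolding r_def by (rule Min_le[OF finD(1)]) (use that in \<open>auto simp: D_def\<close>)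
  \<comment> \<open>Young's inequality with weight \<open>r\<close> puts \<open>1 / (2 * r)\<close>
    in front of the second square. This equals \<open>r / 2 * c\<close>, so the term lands on the
    slack of index \<open>Suc i\<close>, whose weight is \<open>c ^ Suc i\<close>.\<close>
  define c where "c = 1 / r\<^sup>2"
  have c: "c > 0" using r by (simp add: c_def)
  have "(\<Sum>i<n. c ^ i * Re (cnj (w i) * (\<Sum>j<n. J i j * w j)))
      \<le> \<sigma> * (\<Sum>i<n. c ^ i * (cmod (w i))\<^sup>2)" for w
  proof -
    define m where "m i = (if Re (J i i) < \<sigma> then r / 2 * (c ^ i * (cmod (w i))\<^sup>2) else 0)" for i
    have m0: "m i \<ge> 0" for i using r c by (simp add: m_def)
    have mle: "Re (J i i) * (c ^ i * (cmod (w i))\<^sup>2) + 2 * m i \<le> \<sigma> * (c ^ i * (cmod (w i))\<^sup>2)"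
      if "i < n" for i
    proof (cases "Re (J i i) < \<sigma>")
      case True
      have "(Re (J i i) + r) * (c ^ i * (cmod (w i))\<^sup>2) \<le> \<sigma> * (c ^ i * (cmod (w i))\<^sup>2)"
        using rle[OF that True] c by (intro mult_right_mono) auto
      then show ?thesis using True by (simp add: m_def algebra_simps)
    next
      case False
      then show ?thesis using diag[OF that] c by (auto simp: m_def intro!: mult_right_mono)
    qed
    have step: "c ^ i * Re (cnj (w i) * (\<Sum>j<n. J i j * w j))
       \<le> Re (J i i) * (c ^ i * (cmod (w i))\<^sup>2) + m i + (if Suc i < n then m (Suc i) else 0)"
      if i: "i < n" for i
    proof -
      have "(\<Sum>j<n. J i j * w j) = (\<Sum>j\<in>{i} \<union> ({Suc i} \<inter> {..<n}). J i j * w j)"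
        by (rule sum.mono_neutral_right) (use i off in auto)
      also have "\<dots> = J i i * w i + (if Suc i < n then J i (Suc i) * w (Suc i) else 0)"
        by (auto simp: sum.insert)
      finally have s: "(\<Sum>j<n. J i j * w j) = J i i * w i + (if Suc i < n then J i (Suc i) * w (Suc i) else 0)" .
      have d: "Re (cnj (w i) * (J i i * w i)) = Re (J i i) * (cmod (w i))\<^sup>2"
        unfolding cmod_power2 by (simp add: algebra_simps power2_eq_square)
      show ?thesis
      proof (cases "Suc i < n \<and> J i (Suc i) \<noteq> 0")
        case True
        with off[OF i, of "Suc i"] have o: "J i (Suc i) = 1" "Re (J i i) < \<sigma>" "Re (J (Suc i) (Suc i)) < \<sigma>"
          by auto
        have "Re (cnj (w i) * w (Suc i)) \<le> cmod (w i) * cmod (w (Suc i))"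
          using complex_Re_le_cmod[of "cnj (w i) * w (Suc i)"] by (simp add: norm_mult)
        also have "\<dots> \<le> r / 2 * (cmod (w i))\<^sup>2 + r / 2 * c * (cmod (w (Suc i)))\<^sup>2"
        proof -
          have "0 \<le> (r * cmod (w i) - cmod (w (Suc i)))\<^sup>2 / (2 * r)" using r by simp
          also have "\<dots> = r / 2 * (cmod (w i))\<^sup>2 + r / 2 * c * (cmod (w (Suc i)))\<^sup>2 - cmod (w i) * cmod (w (Suc i))"
            using r by (simp add: c_def power2_eq_square field_simps)
          finally show ?thesis by simp
        qed
        finally have "c ^ i * Re (cnj (w i) * w (Suc i)) \<le>
            c ^ i * (r / 2 * (cmod (w i))\<^sup>2 + r / 2 * c * (cmod (w (Suc i)))\<^sup>2)"
          using c by (intro mult_left_mono) auto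
        also have "\<dots> = m i + m (Suc i)" using o by (simp add: m_def algebra_simps)
        finally have "c ^ i * Re (cnj (w i) * w (Suc i)) \<le> m i + m (Suc i)" .
        moreover have "Re (cnj (w i) * (J i i * w i + w (Suc i))) = Re (J i i) * (cmod (w i))\<^sup>2 + Re (cnj (w i) * w (Suc i))"
          using d by (simp add: distrib_left)
        ultimately show ?thesis using True o unfolding s by (simp add: algebra_simps)
      next
        case False
        then have "(\<Sum>j<n. J i j * w j) = J i i * w i" using s by auto
        then show ?thesis using d m0[of i] m0[of "Suc i"] by (auto simp: algebra_simps)
      qed
    qed
    have shift: "(\<Sum>i<n. if Suc i < n then m (Suc i) else 0) \<le> (\<Sum>i<n. m i)"
    proof (cases n)
      case (Suc k)
      have "(\<Sum>i<n. if Suc i < n then m (Suc i) else 0) = (\<Sum>i<k. m (Suc i))"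
        unfolding Suc by simp
      also have "\<dots> \<le> (\<Sum>i<n. m i)" unfolding Suc sum.lessThan_Suc_shift using m0 by simp
      finally show ?thesis .
    qed simp
    have "(\<Sum>i<n. c ^ i * Re (cnj (w i) * (\<Sum>j<n. J i j * w j)))
      \<le> (\<Sum>i<n. Re (J i i) * (c ^ i * (cmod (w i))\<^sup>2) + m i + (if Suc i < n then m (Suc i) else 0))"
      by (intro sum_mono step) auto
    also have "\<dots> \<le> (\<Sum>i<n. Re (J i i) * (c ^ i * (cmod (w i))\<^sup>2) + 2 * m i)"
      using shift by (simp add: sum.distrib sum_distrib_left[symmetric])
    also have "\<dots> \<le> (\<Sum>i<n. \<sigma> * (c ^ i * (cmod (w i))\<^sup>2))"
      by (intro sum_mono mle) auto
    finally show ?thesis by (simp add: sum_distrib_left)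
  qed
  then show thesis using that c by blast
qed

definition pos_def :: "real ^ 'n ^ 'n \<Rightarrow> bool" where
  "pos_def P \<longleftrightarrow> (\<forall>x y. inner x (P *v y) = inner y (P *v x)) \<and> (\<forall>x. x \<noteq> 0 \<longrightarrow> inner x (P *v x) > 0)"

text \<open>If \<open>R\<close> carries \<open>complex_mat A\<close> into Jordan form, the weights
  \<open>c ^ k\<close> on the rows of \<open>R\<close> define a positive Hermitian form. On real
  vectors its real part is given by a real symmetric matrix, which is \<open>P\<close>. The level
  \<open>\<sigma>\<close> serves two cases: 0 for a neutrally stable matrix, a negative number for a
  Hurwitz one.\<close>

lemma jordan_nf_lyapunov:
  fixes A :: "real ^ 'n ^ 'n" and \<sigma> :: real
  assumes nf: "jordan_nf (complex_mat A) nas"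
    and nas: "\<forall>(k, l) \<in> set nas. Re l \<le> \<sigma> \<and> (1 < k \<longrightarrow> Re l < \<sigma>)"
  obtains P where "pos_def P" "\<And>x. inner x (P *v (A *v x)) \<le> \<sigma> * inner x (P *v x)"
proof -
  define n where "n = CARD('n)"
  define e where "e = (index_enum :: nat \<Rightarrow> 'n)"
  have e: "bij_betw e {..<n} UNIV" unfolding e_def n_def by (rule bij_betw_index_enum)
  have sume: "(\<Sum>j\<in>UNIV. g j) = (\<Sum>p<n. g (e p))" for g :: "'n \<Rightarrow> 'z::comm_monoid_add"
    using sum.reindex_bij_betw[OF e, of g] by simp
  define e' where "e' = inv_into {..<n} e"
  have e'[simp]: "e' (e p) = p" if "p < n" for p
    using that e unfolding e'_def by (simp add: bij_betw_def)
  let ?J = "jordan_matrix nas" and ?A = "complex_mat A"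
  have Ac: "?A \<in> carrier_mat n n" by (simp add: complex_mat_def n_def)
  from nf obtain S R where wit: "similar_mat_wit ?A ?J S R"
    unfolding jordan_nf_def similar_mat_def by auto
  have car: "?J \<in> carrier_mat n n" "S \<in> carrier_mat n n" "R \<in> carrier_mat n n"
    and SR: "S * R = 1\<^sub>m n" "R * S = 1\<^sub>m n" and AS: "?A = S * ?J * R"
    using similar_mat_witD2[OF Ac wit] by auto
  have sl: "sum_list (map fst nas) = n" using carrier_matD(1)[OF car(1)] by simp
  have "R * ?A = (R * S) * (?J * R)"
    unfolding AS using car by (simp add: assoc_mult_mat[of _ n n _ n _ n])
  then have RA: "R * ?A = ?J * R" unfolding SR using left_mult_one_mat[OF mult_carrier_mat[OF car(1,3)]] by simp
  define J where "J i j = ?J $$ (i, j)" for i j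
  obtain c where c: "c > 0" and cJ: "\<And>w. (\<Sum>i<n. c ^ i * Re (cnj (w i) * (\<Sum>j<n. J i j * w j)))
      \<le> \<sigma> * (\<Sum>i<n. c ^ i * (cmod (w i))\<^sup>2)"
    by (rule bidiagonal_lyapunov[of n J \<sigma>])
       (use jordan_matrix_entries[OF nas] sl in \<open>auto simp: J_def\<close>)
  \<comment> \<open>\<open>\<phi> x\<close> lists the coordinates of \<open>x\<close> in the Jordan
    basis; by \<open>R * ?A = ?J * R\<close> the matrix \<open>A\<close> acts on them as
    \<open>J\<close>.\<close>
  define \<phi> where "\<phi> x k = (\<Sum>p<n. R $$ (k, p) * complex_of_real (vec_nth x (e p)))" for x :: "real^'n" and k
  have entry: "(X * Y) $$ (i, j) = (\<Sum>p<n. X $$ (i, p) * Y $$ (p, j))"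
    if "X \<in> carrier_mat n n" "Y \<in> carrier_mat n n" "i < n" "j < n" for X Y :: "complex mat" and i j
    using that by (auto simp: scalar_prod_def atLeast0LessThan)
  have Aent: "?A $$ (p, q) = complex_of_real (vec_nth (vec_nth A (e p)) (e q))" if "p < n" "q < n" for p q
    using that by (simp add: complex_mat_def e_def n_def)
  have \<phi>A: "\<phi> (A *v x) k = (\<Sum>m<n. J k m * \<phi> x m)" if k: "k < n" for x k
  proof -
    have "\<phi> (A *v x) k = (\<Sum>p<n. \<Sum>q<n. R $$ (k, p) * ?A $$ (p, q) * complex_of_real (vec_nth x (e q)))"
      unfolding \<phi>_def matrix_vector_mult_def
      by (intro sum.cong refl) (simp add: sume Aent sum_distrib_left mult.assoc)
    also have "\<dots> = (\<Sum>q<n. (R * ?A) $$ (k, q) * complex_of_real (vec_nth x (e q)))"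
      by (subst sum.swap) (auto simp: entry[OF car(3) Ac k] sum_distrib_right intro!: sum.cong simp del: index_mult_mat)
    also have "\<dots> = (\<Sum>q<n. \<Sum>m<n. J k m * (R $$ (m, q) * complex_of_real (vec_nth x (e q))))"
      unfolding RA by (auto simp: entry[OF car(1) car(3) k] J_def sum_distrib_right mult.assoc intro!: sum.cong simp del: index_mult_mat)
    also have "\<dots> = (\<Sum>m<n. J k m * \<phi> x m)"
      by (subst sum.swap) (simp add: \<phi>_def sum_distrib_left)
    finally show ?thesis .
  qed
  have \<phi>inj: "x = 0" if "\<And>k. k < n \<Longrightarrow> \<phi> x k = 0" for x
  proof -
    have "vec_nth x (e p) = 0" if p: "p < n" for p
    proof -
      have "0 = (\<Sum>k<n. S $$ (p, k) * \<phi> x k)" using \<open>\<And>k. k < n \<Longrightarrow> \<phi> x k = 0\<close>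
        by simp
      also have "\<dots> = (\<Sum>q<n. (S * R) $$ (p, q) * complex_of_real (vec_nth x (e q)))"
        unfolding \<phi>_def sum_distrib_left
        by (subst sum.swap) (auto simp: entry[OF car(2) car(3) p] sum_distrib_right mult.assoc intro!: sum.cong simp del: index_mult_mat)
      also have "\<dots> = (\<Sum>q<n. if q = p then complex_of_real (vec_nth x (e q)) else 0)"
        unfolding SR using p by (intro sum.cong) auto
      also have "\<dots> = complex_of_real (vec_nth x (e p))" using p by simp
      finally show ?thesis by simp
    qed
    moreover have "\<exists>p<n. j = e p" for j using e unfolding bij_betw_def by blast
    ultimately have "vec_nth x j = vec_nth 0 j" for j
      by (metis Finite_Cartesian_Product.zero_index)
    then show "x = 0" by (simp add: Finite_Cartesian_Product.vec_eq_iff)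
  qed
  define b where "b x y = (\<Sum>k<n. c ^ k * Re (cnj (\<phi> x k) * \<phi> y k))" for x y
  define P :: "real ^ 'n ^ 'n" where
    "P = (\<chi> i j. \<Sum>k<n. c ^ k * Re (cnj (R $$ (k, e' i)) * R $$ (k, e' j)))"
  have bP: "inner x (P *v y) = b x y" for x y
  proof -
    have "inner x (P *v y) = (\<Sum>p<n. \<Sum>q<n. \<Sum>k<n. c ^ k * Re (cnj (R $$ (k, p)) * R $$ (k, q)) * vec_nth x (e p) * vec_nth y (e q))"
      unfolding inner_vec_def matrix_vector_mult_def sume
      by (intro sum.cong refl) (simp add: P_def sum_distrib_left sum_distrib_right sume mult_ac)
    also have "\<dots> = (\<Sum>p<n. \<Sum>k<n. \<Sum>q<n. c ^ k * Re (cnj (R $$ (k, p)) * R $$ (k, q)) * vec_nth x (e p) * vec_nth y (e q))"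
      by (intro sum.cong refl sum.swap)
    also have "\<dots> = (\<Sum>k<n. \<Sum>p<n. \<Sum>q<n. c ^ k * Re (cnj (R $$ (k, p)) * R $$ (k, q)) * vec_nth x (e p) * vec_nth y (e q))"
      by (rule sum.swap)
    also have "\<dots> = b x y"
      unfolding b_def
    proof (intro sum.cong refl)
      fix k
      have Rer: "Re (z * complex_of_real r) = Re z * r" for z r by simp
      have "cnj (\<phi> x k) * \<phi> y k = (\<Sum>p<n. \<Sum>q<n. cnj (R $$ (k, p)) * R $$ (k, q) * complex_of_real (vec_nth x (e p) * vec_nth y (e q)))"
        unfolding \<phi>_def cnj_sum sum_product by (intro sum.cong refl) (simp add: mult_ac)
      then show "(\<Sum>p<n. \<Sum>q<n. c ^ k * Re (cnj (R $$ (k, p)) * R $$ (k, q)) * vec_nth x (e p) * vec_nth y (e q))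
        = c ^ k * Re (cnj (\<phi> x k) * \<phi> y k)"
        by (simp add: Rer sum_distrib_left mult.assoc[where 'a = real] del: complex_cnj_mult of_real_mult times_complex.sel)
    qed
    finally show ?thesis .
  qed
  have bb: "b x x = (\<Sum>k<n. c ^ k * (cmod (\<phi> x k))\<^sup>2)" for x
  proof -
    have "Re (cnj z * z) = (cmod z)\<^sup>2" for z
      unfolding cmod_power2 by (simp add: power2_eq_square)
    then show ?thesis by (simp only: b_def)
  qed
  show thesis
  proof (rule that[of P])
    show "pos_def P"
      unfolding pos_def_def bP
    proof (intro conjI allI impI)
      show "b x y = b y x" for x y unfolding b_def by (intro sum.cong) (auto simp: algebra_simps)
      fix x :: "real ^ 'n" assume "x \<noteq> 0"
      then obtain k where k: "k < n" "\<phi> x k \<noteq> 0" using \<phi>inj by blast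
      show "b x x > 0" unfolding bb
        by (rule sum_pos2[of _ k]) (use k c in auto)
    qed
    fix x
    have "b x (A *v x) = (\<Sum>k<n. c ^ k * Re (cnj (\<phi> x k) * (\<Sum>m<n. J k m * \<phi> x m)))"
      unfolding b_def by (intro sum.cong) (auto simp: \<phi>A simp del: times_complex.sel)
    also have "\<dots> \<le> \<sigma> * b x x" unfolding bb by (rule cJ)
    finally show "inner x (P *v (A *v x)) \<le> \<sigma> * inner x (P *v x)" unfolding bP .
  qed
qed

text \<open>A block of positive size contributes the factor \<open>[:- l, 1:] ^ k\<close> to the
  characteristic polynomial. This carries spectral bounds over to the list of blocks.\<close>

lemma jordan_nf_eigenvalue:
  fixes M :: "complex mat"
  assumes M: "M \<in> carrier_mat n n" and nf: "jordan_nf M nas" and kl: "(k, l) \<in> set nas"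
  shows "eigenvalue M l"
proof -
  have "k \<noteq> 0" using nf kl unfolding jordan_nf_def by force
  then have "poly ([:- l, 1:] ^ k) l = 0" by simp
  moreover have "[:- l, 1:] ^ k dvd (\<Prod>(k, l)\<leftarrow>nas. [:- l, 1:] ^ k)"
    using kl by (intro prod_list_dvd) force
  ultimately have "poly (char_poly M) l = 0"
    unfolding jordan_nf_char_poly[OF nf] by (metis dvd_def mult_eq_0_iff poly_mult)
  then show ?thesis using eigenvalue_root_char_poly[OF M] by simp
qed

lemma neutrally_stable_lyapunov:
  fixes A :: "real ^ 'n ^ 'n"
  assumes "neutrally_stable A"
  obtains P where "pos_def P" "\<And>x. inner x (P *v (A *v x)) \<le> 0"
proof -
  obtain nas where nf: "jordan_nf (complex_mat A) nas" and z: "\<forall>(k, l) \<in> set nas. Re l = 0 \<longrightarrow> k = 1"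
    and ev: "\<And>l. eigenvalue (complex_mat A) l \<Longrightarrow> Re l \<le> 0"
    using assms unfolding neutrally_stable_def by auto
  have Ac: "complex_mat A \<in> carrier_mat CARD('n) CARD('n)" by (simp add: complex_mat_def)
  have "\<forall>(k, l) \<in> set nas. Re l \<le> 0 \<and> (1 < k \<longrightarrow> Re l < 0)"
    using z ev[OF jordan_nf_eigenvalue[OF Ac nf]] by force
  from jordan_nf_lyapunov[OF nf this] show thesis using that by auto
qed

lemma hurwitz_lyapunov:
  fixes A :: "real ^ 'n ^ 'n"
  assumes "hurwitz A"
  obtains P \<epsilon> where "pos_def P" "\<epsilon> > 0" "\<And>x. inner x (P *v (A *v x)) \<le> - \<epsilon> * inner x (P *v x)"
proof -
  have Ac: "complex_mat A \<in> carrier_mat CARD('n) CARD('n)" by (simp add: complex_mat_def)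
  obtain nas where nf: "jordan_nf (complex_mat A) nas"
    using char_poly_factorized[OF Ac] jordan_nf_exists[OF Ac] by blast
  \<comment> \<open>Half of the distance of the spectrum to the imaginary axis, capped by 1: every
    block then lies strictly to the left of \<open>- \<epsilon>\<close>, so blocks of any size are
    admissible at that level.\<close>
  define \<epsilon> where "\<epsilon> = Min (insert 1 ((\<lambda>(k, l). - Re l / 2) ` set nas))"
  have neg: "Re l < 0" if "(k, l) \<in> set nas" for k l
    using assms jordan_nf_eigenvalue[OF Ac nf that] by (auto simp: hurwitz_def)
  have \<epsilon>: "\<epsilon> > 0" unfolding \<epsilon>_def by (subst Min_gr_iff) (auto dest: neg)
  have "\<epsilon> \<le> - Re l / 2" if "(k, l) \<in> set nas" for k l
    unfolding \<epsilon>_def by (rule Min_le) (use that in force)+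
  then have "\<forall>(k, l) \<in> set nas. Re l \<le> - \<epsilon> \<and> (1 < k \<longrightarrow> Re l < - \<epsilon>)"
    using neg by fastforce
  from jordan_nf_lyapunov[OF nf this] show thesis using that \<epsilon> by blast
qed

text \<open>The characteristic polynomial is invariant under transposition. The costate evolves
  under the transpose of the closed loop matrix, which is where this is used.\<close>

lemma hurwitz_transpose:
  fixes A :: "real ^ 'n ^ 'n"
  assumes "hurwitz A"
  shows "hurwitz (transpose A)"
proof -
  have Ac: "complex_mat A \<in> carrier_mat CARD('n) CARD('n)" for A :: "real ^ 'n ^ 'n"
    by (simp add: complex_mat_def)
  have "complex_mat (transpose A) = transpose_mat (complex_mat A)"
    unfolding complex_mat_def by (intro eq_matI) (auto simp: transpose_def)
  then show ?thesis using assms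
    unfolding hurwitz_def eigenvalue_root_char_poly[OF Ac] by (simp add: char_poly_transpose_mat[OF Ac])
qed

section \<open>The flow of a linear system\<close>

text \<open>Coordinate \<open>i\<close> of \<open>exp (z A) x\<close>. The argument ranges over any
  Banach field: the real instance gives the flow, and the complex one exhibits it as the restriction
  of an entire function.\<close>

definition flow_series :: "real ^ 'n ^ 'n \<Rightarrow> real ^ 'n \<Rightarrow> 'n \<Rightarrow> 'a::{real_normed_field,banach} \<Rightarrow> 'a" where
  "flow_series A x i z = (\<Sum>k. of_real (vec_nth (((*v) A ^^ k) x) i / fact k) * z ^ k)"

definition flow :: "real ^ 'n ^ 'n \<Rightarrow> real ^ 'n \<Rightarrow> real \<Rightarrow> real ^ 'n" where
  "flow A x t = (\<chi> i. flow_series A x i t)"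

lemma norm_iterate_matrix_vector:
  fixes A :: "real ^ 'n ^ 'n"
  shows "norm (((*v) A ^^ k) x) \<le> onorm ((*v) A) ^ k * norm x"
proof (induction k)
  case (Suc k)
  have bl: "bounded_linear ((*v) A)" by (rule matrix_vector_mul_bounded_linear)
  have "norm (((*v) A ^^ Suc k) x) \<le> onorm ((*v) A) * norm (((*v) A ^^ k) x)"
    using onorm[OF bl] by simp
  also have "\<dots> \<le> onorm ((*v) A) * (onorm ((*v) A) ^ k * norm x)"
    by (intro mult_left_mono Suc onorm_pos_le[OF bl])
  finally show ?case by (simp add: mult_ac)
qed simp

lemma summable_flow_series:
  fixes A :: "real ^ 'n ^ 'n" and z :: "'a::{real_normed_field,banach}"
  shows "summable (\<lambda>k. of_real (vec_nth (((*v) A ^^ k) x) i / fact k) * z ^ k)"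
proof (rule summable_comparison_test)
  let ?C = "onorm ((*v) A)"
  show "summable (\<lambda>k. norm x * ((?C * norm z) ^ k /\<^sub>R fact k))"
    by (intro summable_mult summable_exp_generic)
  show "\<exists>N. \<forall>k\<ge>N. norm (of_real (vec_nth (((*v) A ^^ k) x) i / fact k) * z ^ k) \<le> norm x * ((?C * norm z) ^ k /\<^sub>R fact k)"
  proof (intro exI allI impI)
    fix k
    have "\<bar>vec_nth (((*v) A ^^ k) x) i\<bar> \<le> ?C ^ k * norm x"
      using component_le_norm_cart norm_iterate_matrix_vector order_trans by blast
    then have "\<bar>vec_nth (((*v) A ^^ k) x) i\<bar> * (norm z ^ k / fact k) \<le> ?C ^ k * norm x * (norm z ^ k / fact k)"
      by (intro mult_right_mono) auto
    then show "norm (of_real (vec_nth (((*v) A ^^ k) x) i / fact k) * z ^ k) \<le> norm x * ((?C * norm z) ^ k /\<^sub>R fact k)"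
      unfolding norm_mult norm_power norm_of_real
      by (simp add: power_mult_distrib divide_simps mult_ac)
  qed
qed

lemma flow_series_linear:
  "flow_series A (x + y) i z = flow_series A x i z + flow_series A y i z"
  "flow_series A (c *\<^sub>R x) i z = of_real c * flow_series A x i z"
proof -
  have lin: "linear ((*v) A ^^ k)" for k
  proof (induction k)
    case (Suc k)
    then show ?case using linear_compose[OF _ matrix_vector_mul_linear[of A]] by (simp add: o_def)
  qed (simp add: linear_id[unfolded id_def])
  show "flow_series A (x + y) i z = flow_series A x i z + flow_series A y i z"
    unfolding flow_series_def
    by (subst suminf_add[OF summable_flow_series summable_flow_series])
       (simp add: linear_add[OF lin] add_divide_distrib distrib_right)
  show "flow_series A (c *\<^sub>R x) i z = of_real c * flow_series A x i z"
    unfolding flow_series_def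
    by (subst suminf_mult[OF summable_flow_series, symmetric])
       (simp add: linear_cmul[OF lin] mult_ac)
qed

lemma linear_flow: "linear (\<lambda>x. flow A x t)"
  by (rule linearI) (simp_all add: flow_def Finite_Cartesian_Product.vec_eq_iff flow_series_linear)

lemma flow_series_of_real: "flow_series A x i (of_real t) = of_real (flow_series A x i t)"
proof -
  have "summable (\<lambda>k. vec_nth (((*v) A ^^ k) x) i / fact k * t ^ k)"
    using summable_flow_series[of A x i t] by (simp only: of_real_eq_id id_apply)
  from suminf_of_real[OF this, symmetric] show ?thesis
    by (simp only: flow_series_def of_real_mult of_real_power of_real_eq_id id_apply)
qed

text \<open>Termwise differentiation shifts the coefficients by one, and a shifted iterate of
  \<open>A\<close> on \<open>x\<close> is an iterate on \<open>A *v x\<close>.\<close>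

lemma DERIV_flow_series:
  fixes A :: "real ^ 'n ^ 'n" and z :: "'a::{real_normed_field,banach}"
  shows "(flow_series A x i has_field_derivative flow_series A (A *v x) i z) (at z)"
proof -
  let ?c = "\<lambda>k. of_real (vec_nth (((*v) A ^^ k) x) i / fact k) :: 'a"
  have "diffs ?c = (\<lambda>k. of_real (vec_nth (((*v) A ^^ k) (A *v x)) i / fact k))"
  proof
    fix k
    have "real (Suc k) * (r / fact (Suc k)) = r / fact k" for r
      by (simp add: field_simps del: of_nat_Suc)
    then have "of_nat (Suc k) * of_real (r / fact (Suc k)) = (of_real (r / fact k) :: 'a)" for r
      by (metis of_real_mult of_real_of_nat_eq)
    then show "diffs ?c k = of_real (vec_nth (((*v) A ^^ k) (A *v x)) i / fact k)"
      unfolding diffs_def funpow_Suc_right o_apply by blast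
  qed
  then show ?thesis
    using termdiffs_strong_converges_everywhere[OF summable_flow_series, of A x i z]
    by (simp add: flow_series_def[abs_def])
qed

lemma iterate_matrix_commute: "((*v) A ^^ k) (A *v x) = A *v ((*v) A ^^ k) x"
  by (simp add: funpow_swap1)

text \<open>The exponential commutes with \<open>A\<close>, which turns the derivative
  \<open>flow A (A *v x) t\<close> into the right-hand side of the differential equation.\<close>

lemma flow_matrix_vector: "flow A (A *v x) t = A *v flow A x t"
proof -
  have "flow_series A (A *v x) i t = (\<Sum>j\<in>UNIV. vec_nth (vec_nth A i) j * flow_series A x j t)" for i
  proof -
    have sm: "summable (\<lambda>k. vec_nth (((*v) A ^^ k) x) j / fact k * t ^ k)" for j
      using summable_flow_series[of A x j t] by (simp only: of_real_eq_id id_apply)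
    have "(\<Sum>j\<in>UNIV. vec_nth (vec_nth A i) j * flow_series A x j t)
      = (\<Sum>k. \<Sum>j\<in>UNIV. vec_nth (vec_nth A i) j * (vec_nth (((*v) A ^^ k) x) j / fact k * t ^ k))"
      unfolding flow_series_def of_real_eq_id id_apply
      by (simp only: suminf_sum[OF summable_mult[OF sm]] suminf_mult[OF sm])
    also have "\<dots> = flow_series A (A *v x) i t"
      unfolding flow_series_def iterate_matrix_commute
      by (simp add: matrix_vector_mult_def sum_divide_distrib sum_distrib_left mult_ac)
    finally show ?thesis ..
  qed
  then show ?thesis by (simp add: flow_def matrix_vector_mult_def Finite_Cartesian_Product.vec_eq_iff)
qed

lemma has_vector_derivative_flow:
  fixes A :: "real ^ 'n ^ 'n"
  shows "((\<lambda>t. flow A x t) has_vector_derivative A *v flow A x t) (at t within S)"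
  unfolding flow_matrix_vector[symmetric] has_vector_derivative_def
proof (subst has_derivative_componentwise_within, rule)
  fix b :: "real ^ 'n" assume "b \<in> Basis"
  then obtain i where b: "b = axis i 1" by (auto simp: Basis_vec_def)
  have "(flow_series A x i has_derivative (\<lambda>h. h * flow_series A (A *v x) i t)) (at t within S)"
    using DERIV_flow_series[of A x i t] unfolding has_field_derivative_def mult.commute[of "flow_series _ _ _ _"]
    by (rule has_derivative_at_withinI)
  then show "((\<lambda>t. inner (flow A x t) b) has_derivative (\<lambda>h. inner (h *\<^sub>R flow A (A *v x) t) b)) (at t within S)"
    by (simp add: b inner_axis flow_def)
qed

lemma flow_0 [simp]: "flow A x 0 = x"
  unfolding flow_def flow_series_def powser_zero by (simp add: Finite_Cartesian_Product.vec_eq_iff)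

lemma continuous_on_flow: "continuous_on S (flow A x)"
  by (rule continuous_on_vector_derivative) (rule has_vector_derivative_flow)

text \<open>One coordinate that is nonzero at \<open>t0\<close> suffices, since every zero of the
  vector is a zero of that coordinate. The coordinate extends to the entire function
  \<open>h\<close>, and a nonconstant one has finitely many zeros on a compact segment.\<close>

lemma finite_zeros_flow:
  fixes A :: "real ^ 'n ^ 'n" and M :: "real ^ 'n ^ 'k"
  assumes "M *v flow A x t0 \<noteq> 0"
  shows "finite {t \<in> {a..b}. M *v flow A x t = 0}"
proof -
  obtain i where i: "vec_nth (M *v flow A x t0) i \<noteq> 0"
    using assms by (auto simp: Finite_Cartesian_Product.vec_eq_iff)
  define h :: "complex \<Rightarrow> complex" where
    "h z = (\<Sum>j\<in>UNIV. of_real (vec_nth (vec_nth M i) j) * flow_series A x j z)" for z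
  have h: "h (of_real t) = of_real (vec_nth (M *v flow A x t) i)" for t
    by (simp add: h_def flow_series_of_real matrix_vector_mult_def flow_def)
  have "flow_series A x j holomorphic_on UNIV" for j
    using DERIV_flow_series[of A x j] by (subst holomorphic_on_open) blast+
  then have hol: "h holomorphic_on UNIV"
    unfolding h_def by (intro holomorphic_intros)
  have sub: "of_real ` {t \<in> {a..b}. M *v flow A x t = 0} \<subseteq> {z \<in> of_real ` {a..b}. h z = 0}"
    by (auto simp: h)
  show ?thesis
  \<comment> \<open>A constant \<open>h\<close> keeps its nonzero value at \<open>t0\<close>, so the
    zero set is empty.\<close>
  proof (cases "h constant_on UNIV")
    case True
    then have "h (of_real t) = h (of_real t0)" for t unfolding constant_on_def by (metis UNIV_I)
    then have "vec_nth (M *v flow A x t) i \<noteq> 0" for t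
      using i h[of t] h[of t0] by (metis of_real_eq_iff)
    then have "{t \<in> {a..b}. M *v flow A x t = 0} = {}" by auto (metis Finite_Cartesian_Product.zero_index)
    then show ?thesis by (simp only: finite.emptyI)
  next
    case False
    have "compact (complex_of_real ` {a..b})"
      by (intro compact_continuous_image continuous_intros) auto
    then have "finite {z \<in> complex_of_real ` {a..b}. h z = 0}"
      using holomorphic_compact_finite_zeros[OF hol _ _ _ _ False] by auto
    then have "finite (complex_of_real ` {t \<in> {a..b}. M *v flow A x t = 0})"
      by (rule finite_subset[OF sub])
    then show ?thesis by (rule finite_imageD) (simp add: inj_on_def)
  qed
qed

section \<open>Dissipation and observability\<close>

abbreviation quad :: "real ^ 'n ^ 'n \<Rightarrow> real ^ 'n \<Rightarrow> real" where
  "quad P x \<equiv> inner x (P *v x)"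

lemma inner_matrix_vector_transpose: "inner x (M *v y) = inner (transpose M *v x) y"
  for M :: "real ^ 'n ^ 'm"
  by (simp add: dot_lmul_matrix)

lemma pos_def_sym: "pos_def P \<Longrightarrow> inner x (P *v y) = inner y (P *v x)"
  by (simp add: pos_def_def)

lemma pos_def_nonneg: "pos_def P \<Longrightarrow> quad P x \<ge> 0"
  by (cases "x = 0") (auto simp: pos_def_def less_imp_le)

lemma norm_matrix_vector_le: "norm (M *v x) \<le> onorm ((*v) M) * norm x"
  for M :: "real ^ 'n ^ 'm"
  by (rule onorm[OF matrix_vector_mul_bounded_linear])

lemma onorm_matrix_nonneg: "0 \<le> onorm ((*v) M)"
  for M :: "real ^ 'n ^ 'm"
  by (rule onorm_pos_le[OF matrix_vector_mul_bounded_linear])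

text \<open>The parallelogram law, with the nonnegative term of \<open>u + v\<close>
  dropped.\<close>

lemma quad_diff_le:
  fixes N :: "real ^ 'n ^ 'n"
  assumes sym: "\<And>u v. inner u (N *v v) = inner v (N *v u)" and "\<And>u. quad N u \<ge> 0"
  shows "quad N (u - v) \<le> 2 * quad N u + 2 * quad N v"
proof -
  have "quad N (u - v) + quad N (u + v) = 2 * quad N u + 2 * quad N v"
    using sym[of u v]
    by (simp add: matrix_vector_mult_diff_distrib matrix_vector_right_distrib inner_add_left inner_add_right inner_diff_left inner_diff_right)
  then show ?thesis using assms(2)[of "u + v"] by linarith
qed

lemma continuous_on_matrix_vector: "continuous_on S y \<Longrightarrow> continuous_on S (\<lambda>s. N *v y s)"
  for N :: "real ^ 'i ^ 'j" and y :: "real \<Rightarrow> real ^ 'i"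
  by (rule bounded_linear.continuous_on[OF matrix_vector_mul_bounded_linear])

text \<open>\<open>c\<close> is the minimum of the form on the unit sphere, extended by homogeneity;
  \<open>C\<close> is the operator norm plus 1, which makes it visibly positive.\<close>

lemma pos_def_bounds:
  fixes P :: "real ^ 'n ^ 'n"
  assumes P: "pos_def P"
  obtains c C where "c > 0" "C > 0" "\<And>x. c * (norm x)\<^sup>2 \<le> quad P x" "\<And>x. quad P x \<le> C * (norm x)\<^sup>2"
proof -
  have "continuous_on (sphere (0 :: real ^ 'n) 1) (quad P)"
    by (intro continuous_intros matrix_vector_mult_linear_continuous_on)
  then obtain u :: "real ^ 'n" where u: "u \<in> sphere 0 1" "\<And>v. v \<in> sphere 0 1 \<Longrightarrow> quad P u \<le> quad P v"
    using continuous_attains_inf[of "sphere (0 :: real ^ 'n) 1" "quad P"] by auto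
  have c: "quad P u > 0" using u(1) P unfolding pos_def_def by (metis norm_zero dist_0_norm mem_sphere zero_neq_one)
  have lower: "quad P u * (norm x)\<^sup>2 \<le> quad P x" for x
  proof (cases "x = 0")
    case False
    define v where "v = x /\<^sub>R norm x"
    have x: "x = norm x *\<^sub>R v" using False by (simp add: v_def)
    have "quad P x = (norm x)\<^sup>2 * quad P v"
      by (subst (1 2) x) (simp add: power2_eq_square matrix_vector_mult_scaleR)
    moreover have "quad P u \<le> quad P v" using False by (intro u) (simp add: v_def)
    ultimately show ?thesis by (simp add: mult_right_mono mult.commute)
  qed simp
  have "quad P x \<le> (onorm ((*v) P) + 1) * (norm x)\<^sup>2" for x
  proof -
    have "quad P x \<le> norm x * (onorm ((*v) P) * norm x)"
      using norm_cauchy_schwarz order_trans mult_left_mono[OF norm_matrix_vector_le norm_ge_zero] by blast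
    also have "\<dots> \<le> (onorm ((*v) P) + 1) * (norm x)\<^sup>2"
      by (simp add: power2_eq_square algebra_simps)
    finally show ?thesis .
  qed
  moreover have "onorm ((*v) P) + 1 > 0" using onorm_matrix_nonneg[of P] by linarith
  ultimately show thesis using that c lower by blast
qed

text \<open>If \<open>y = M *v x\<close> were nonzero, the form would have nonzero slope at its zero
  \<open>x\<close> in direction \<open>y\<close>, so a step backwards would make it
  negative.\<close>

lemma psd_kernel:
  fixes M :: "real ^ 'n ^ 'n"
  assumes sym: "\<And>x y. inner x (M *v y) = inner y (M *v x)" and psd: "\<And>x. quad M x \<ge> 0"
    and 0: "quad M x = 0"
  shows "M *v x = 0"
proof (rule ccontr)
  define y where "y = M *v x"
  define a where "a = inner y y"
  define c where "c = quad M y"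
  \<comment> \<open>At this step length the linear term of \<open>2 * t * a + t * t * c\<close>
    outweighs the quadratic one; the 1 covers \<open>c = 0\<close>.\<close>
  define t where "t = - a / (c + 1)"
  assume "M *v x \<noteq> 0"
  then have a: "a > 0" by (simp add: a_def y_def)
  have c: "c \<ge> 0" unfolding c_def by (rule psd)
  have "0 \<le> quad M (x + t *\<^sub>R y)" by (rule psd)
  also have "\<dots> = 2 * t * a + t * t * c"
    using 0 sym[of x y]
    by (simp add: a_def c_def matrix_vector_right_distrib matrix_vector_mult_scaleR inner_add_left inner_add_right)
       (simp add: y_def algebra_simps)
  also have "\<dots> = (- (a * a) * (c + 2)) / (c + 1)\<^sup>2"
    using c by (simp add: t_def divide_simps) (simp add: power2_eq_square algebra_simps)
  also have "\<dots> < 0" using a c by (intro divide_neg_pos) (auto simp: mult_neg_pos)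
  finally show False by simp
qed

lemma has_derivative_quad:
  fixes P :: "real ^ 'n ^ 'n"
  assumes P: "pos_def P" and y: "(y has_vector_derivative y') (at t within S)"
  shows "((\<lambda>t. quad P (y t)) has_real_derivative 2 * inner (y t) (P *v y')) (at t within S)"
proof -
  have "((\<lambda>t. P *v y t) has_vector_derivative P *v y') (at t within S)"
    by (rule bounded_linear.has_vector_derivative[OF matrix_vector_mul_bounded_linear y])
  from bounded_bilinear.has_vector_derivative[OF bounded_bilinear_inner y this]
  have "((\<lambda>t. quad P (y t)) has_vector_derivative inner (y t) (P *v y') + inner y' (P *v y t)) (at t within S)"
    by simp
  then show ?thesis
    using pos_def_sym[OF P, of y' "y t"] by (simp add: has_real_derivative_iff_has_vector_derivative)
qed

lemma quad_flow_le:
  fixes A :: "real ^ 'n ^ 'n"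
  assumes P: "pos_def P" and diss: "\<And>x. inner x (P *v (A *v x)) \<le> 0" and t: "t \<ge> 0"
  shows "quad P (flow A x t) \<le> quad P x"
proof -
  have "quad P (flow A x t) \<le> quad P (flow A x 0)"
  proof (rule DERIV_nonpos_imp_nonincreasing[OF t])
    fix s :: real
    show "\<exists>D. ((\<lambda>t. quad P (flow A x t)) has_real_derivative D) (at s) \<and> D \<le> 0"
      using has_derivative_quad[OF P has_vector_derivative_flow, of A x s UNIV] diss[of "flow A x s"]
      by (intro exI[of _ "2 * inner (flow A x s) (P *v (A *v flow A x s))"]) auto
  qed
  then show ?thesis by simp
qed

section \<open>The dissipation matrix and its unobserved trajectories\<close>

definition dissipation :: "real ^ 'n ^ 'n \<Rightarrow> real ^ 'm ^ 'n \<Rightarrow> real ^ 'n ^ 'n \<Rightarrow> real ^ 'n ^ 'n" where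
  "dissipation A B P = 2 *\<^sub>R (P ** (B ** (transpose B ** P)))
     - (transpose A ** P + P ** A)"

lemma dissipation_form:
  fixes A :: "real ^ 'n ^ 'n" and B :: "real ^ 'm ^ 'n"
  assumes P: "pos_def P"
  shows "inner x (dissipation A B P *v y) =
    2 * inner (transpose B *v (P *v x)) (transpose B *v (P *v y))
    - inner y (P *v (A *v x)) - inner x (P *v (A *v y))"
proof -
  let ?w = "transpose B *v (P *v y)"
  have "inner x (P *v (B *v ?w)) = inner (P *v x) (B *v ?w)"
    by (subst pos_def_sym[OF P]) (rule inner_commute)
  also have "\<dots> = inner (transpose B *v (P *v x)) ?w"
    by (rule inner_matrix_vector_transpose)
  finally have "inner x (P *v (B *v ?w)) = inner (transpose B *v (P *v x)) ?w" .
  moreover have "inner x (transpose A *v (P *v y)) = inner y (P *v (A *v x))"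
  proof -
    have "inner x (transpose A *v (P *v y)) = inner (P *v y) (A *v x)"
      by (subst inner_commute) (rule inner_matrix_vector_transpose[symmetric])
    also have "\<dots> = inner y (P *v (A *v x))"
      by (subst pos_def_sym[OF P]) (rule inner_commute)
    finally show ?thesis .
  qed
  ultimately show ?thesis
    unfolding dissipation_def matrix_vector_mult_diff_rdistrib matrix_vector_mult_add_rdistrib
      scaleR_matrix_vector_assoc[symmetric] matrix_vector_mul_assoc[symmetric] inner_diff_right inner_add_right inner_scaleR_right
    by linarith
qed

lemma dissipation_properties:
  fixes A :: "real ^ 'n ^ 'n" and B :: "real ^ 'm ^ 'n"
  assumes P: "pos_def P" and diss: "\<And>x. inner x (P *v (A *v x)) \<le> 0"
  shows "inner x (dissipation A B P *v y) = inner y (dissipation A B P *v x)"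
    and "quad (dissipation A B P) x =
      2 * (norm (transpose B *v (P *v x)))\<^sup>2 - 2 * inner x (P *v (A *v x))"
    and "2 * (norm (transpose B *v (P *v x)))\<^sup>2 \<le> quad (dissipation A B P) x"
proof -
  show "inner x (dissipation A B P *v y) = inner y (dissipation A B P *v x)"
    unfolding dissipation_form[OF P] by (simp add: inner_commute)
  show e: "quad (dissipation A B P) x =
      2 * (norm (transpose B *v (P *v x)))\<^sup>2 - 2 * inner x (P *v (A *v x))"
    unfolding dissipation_form[OF P] power2_norm_eq_inner by simp
  show "2 * (norm (transpose B *v (P *v x)))\<^sup>2 \<le> quad (dissipation A B P) x"
    unfolding e using diss[of x] by simp
qed

text \<open>Both shares of the dissipation are nonnegative, so the output vanishes with their sum.
  What is left of \<open>dissipation A B P *v x = 0\<close> is the Lyapunov part, which says that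
  \<open>A\<close> acts on \<open>x\<close> as a skew-adjoint map for the inner product of
  \<open>P\<close>.\<close>

lemma dissipation_kernel:
  fixes A :: "real ^ 'n ^ 'n" and B :: "real ^ 'm ^ 'n"
  assumes P: "pos_def P" and diss: "\<And>x. inner x (P *v (A *v x)) \<le> 0"
    and 0: "dissipation A B P *v x = 0"
  shows "transpose B *v (P *v x) = 0"
    and "P *v (A *v x) = - (transpose A *v (P *v x))"
proof -
  have "quad (dissipation A B P) x = 0" using 0 by simp
  then have "(norm (transpose B *v (P *v x)))\<^sup>2 \<le> 0"
    using dissipation_properties(3)[OF P diss, of B x] by linarith
  then show B: "transpose B *v (P *v x) = 0" by simp
  have "0 = dissipation A B P *v x" using 0 by simp
  also have "\<dots> = - (transpose A *v (P *v x)) - P *v (A *v x)"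
    unfolding dissipation_def matrix_vector_mult_diff_rdistrib matrix_vector_mult_add_rdistrib
      scaleR_matrix_vector_assoc[symmetric] matrix_vector_mul_assoc[symmetric] B by simp
  finally show "P *v (A *v x) = - (transpose A *v (P *v x))"
    by (simp add: algebra_simps)
qed

text \<open>On an unobserved trajectory \<open>y\<close> the costate \<open>z = P y\<close> solves \<open>z' = - (A + B K)\<^sup>T z\<close> for every
  \<open>K\<close>, so it grows exponentially if \<open>A + B K\<close> is Hurwitz; but \<open>y\<close> is bounded.\<close>
lemma flow_observable:
  fixes A :: "real ^ 'n ^ 'n" and B :: "real ^ 'm ^ 'n"
  assumes st: "stabilizable A B" and P: "pos_def P" and diss: "\<And>x. inner x (P *v (A *v x)) \<le> 0"
    and un: "\<And>t. t \<ge> 0 \<Longrightarrow> dissipation A B P *v flow A x t = 0"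
  shows "x = 0"
proof -
  obtain K :: "real ^ 'n ^ 'm" where "hurwitz (A + B ** K)" using st by (auto simp: stabilizable_def)
  from hurwitz_lyapunov[OF hurwitz_transpose[OF this]]
  obtain P0 \<epsilon> where P0: "pos_def P0" and \<epsilon>: "\<epsilon> > 0"
    and P0d: "\<And>x. inner x (P0 *v (transpose (A + B ** K) *v x)) \<le> - \<epsilon> * quad P0 x"
    by blast
  define z where "z t = P *v flow A x t" for t
  have z': "(z has_vector_derivative - (transpose (A + B ** K) *v z t)) (at t)" if t: "t \<ge> 0" for t
  proof -
    note k = dissipation_kernel[OF P diss un[OF t]]
    have tr: "transpose (A + B ** K) *v v
      = transpose A *v v + transpose K *v (transpose B *v v)" for v
    proof -
      have "transpose (A + B ** K) = transpose A + transpose K ** transpose B"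
        unfolding matrix_transpose_mul[symmetric] by (simp add: transpose_def Finite_Cartesian_Product.vec_eq_iff)
      then show ?thesis by (simp only: matrix_vector_mult_add_rdistrib matrix_vector_mul_assoc)
    qed
    have "(z has_vector_derivative P *v (A *v flow A x t)) (at t)"
      unfolding z_def
      by (rule bounded_linear.has_vector_derivative[OF matrix_vector_mul_bounded_linear has_vector_derivative_flow])
    \<comment> \<open>Since \<open>transpose B *v z t\<close> vanishes, the feedback term of the
      transposed closed loop costs nothing.\<close>
    then show ?thesis unfolding tr unfolding z_def k by simp
  qed
  \<comment> \<open>The storage of \<open>z\<close> grows at rate at least
    \<open>2 * \<epsilon>\<close>: the equation runs the stable closed loop backwards. The
    exponential weight compensates exactly this rate.\<close>
  have mono: "quad P0 (z 0) \<le> quad P0 (z t) * exp (- 2 * \<epsilon> * t)" if t: "t \<ge> 0" for t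
  proof -
    have "quad P0 (z 0) * exp (- 2 * \<epsilon> * 0) \<le> quad P0 (z t) * exp (- 2 * \<epsilon> * t)"
    proof (rule DERIV_nonneg_imp_nondecreasing[OF t])
      fix s :: real assume s: "0 \<le> s"
      let ?D = "2 * inner (z s) (P0 *v - (transpose (A + B ** K) *v z s)) * exp (- 2 * \<epsilon> * s)
        + - 2 * \<epsilon> * exp (- 2 * \<epsilon> * s) * quad P0 (z s)"
      have "((\<lambda>s. quad P0 (z s) * exp (- 2 * \<epsilon> * s)) has_real_derivative ?D) (at s)"
        by (intro DERIV_mult has_derivative_quad[OF P0] z' s) (auto intro!: derivative_eq_intros)
      moreover have "?D = exp (- 2 * \<epsilon> * s) * 2 * (- inner (z s) (P0 *v (transpose (A + B ** K) *v z s)) - \<epsilon> * quad P0 (z s))"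
        by (simp add: linear_neg[OF matrix_vector_mul_linear] algebra_simps del: transpose_matrix_vector)
      moreover have "\<dots> \<ge> 0" using P0d[of "z s"] by (intro mult_nonneg_nonneg) auto
      ultimately show "\<exists>D. ((\<lambda>s. quad P0 (z s) * exp (- 2 * \<epsilon> * s)) has_real_derivative D) (at s) \<and> 0 \<le> D"
        by (intro exI[of _ ?D]) simp
    qed
    then show ?thesis by simp
  qed
  obtain c C where c: "c > 0" "C > 0" "\<And>x. c * (norm x)\<^sup>2 \<le> quad P x" "\<And>x. quad P x \<le> C * (norm x)\<^sup>2"
    by (rule pos_def_bounds[OF P]) (rule that)
  obtain c0 C0 where C0: "c0 > 0" "C0 > 0" "\<And>x. c0 * (norm x)\<^sup>2 \<le> quad P0 x" "\<And>x. quad P0 x \<le> C0 * (norm x)\<^sup>2"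
    by (rule pos_def_bounds[OF P0]) (rule that)
  \<comment> \<open>The form of \<open>P\<close> does not increase along the flow, so the costate
    stays bounded; \<open>D\<close> bounds its \<open>P0\<close> storage by the initial storage of
    \<open>x\<close>.\<close>
  define D where "D = C0 * ((onorm ((*v) P))\<^sup>2 * (quad P x / c))"
  have bd: "quad P0 (z t) \<le> D" if t: "t \<ge> 0" for t
  proof -
    have "(norm (flow A x t))\<^sup>2 \<le> quad P x / c"
      using c(3)[of "flow A x t"] quad_flow_le[OF P diss t, of x] c(1) by (simp add: field_simps)
    moreover have "(norm (z t))\<^sup>2 \<le> (onorm ((*v) P))\<^sup>2 * (norm (flow A x t))\<^sup>2"
      unfolding z_def power_mult_distrib[symmetric] by (intro power_mono norm_matrix_vector_le) simp
    ultimately have "(norm (z t))\<^sup>2 \<le> (onorm ((*v) P))\<^sup>2 * (quad P x / c)"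
      by (meson mult_left_mono order_trans zero_le_power2)
    then show ?thesis using C0(2,4) unfolding D_def by (meson mult_left_mono order_trans less_imp_le)
  qed
  have "((\<lambda>t. D * exp (- 2 * \<epsilon> * t)) \<longlongrightarrow> 0) at_top"
    using \<epsilon> by real_asymp
  moreover have "eventually (\<lambda>t. quad P0 (z 0) \<le> D * exp (- 2 * \<epsilon> * t)) at_top"
    using eventually_ge_at_top[of 0]
  proof eventually_elim
    case (elim t)
    then show ?case using mono[of t] bd[of t] by (meson exp_ge_zero mult_right_mono order_trans)
  qed
  ultimately have "quad P0 (z 0) \<le> 0"
    by (intro tendsto_lowerbound) auto
  then have "z 0 = 0" using P0 by (auto simp: pos_def_def not_less[symmetric])
  then have "quad P x = 0" by (simp add: z_def)
  then show "x = 0" using P unfolding pos_def_def by (metis less_irrefl)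
qed

section \<open>Uniform observability under persistent excitation\<close>

lemma integrable_times_continuous:
  fixes \<alpha> f :: "real \<Rightarrow> real"
  assumes "\<alpha> \<in> borel_measurable (lebesgue_on {a..b})" "\<And>s. s \<in> {a..b} \<Longrightarrow> \<alpha> s \<in> {0..1}"
    and f: "continuous_on {a..b} f"
  shows "(\<lambda>s. \<alpha> s * f s) integrable_on {a..b}"
proof (rule measurable_bounded_by_integrable_imp_integrable_real)
  show "(\<lambda>s. \<alpha> s * f s) \<in> borel_measurable (lebesgue_on {a..b})"
    by (intro borel_measurable_times assms continuous_imp_measurable_on_sets_lebesgue) auto
  show "(\<lambda>s. \<bar>f s\<bar>) integrable_on {a..b}"
    by (intro integrable_continuous_real continuous_intros f)
  show "\<bar>\<alpha> s * f s\<bar> \<le> \<bar>f s\<bar>" if "s \<in> {a..b}" for s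
    using assms(2)[OF that] by (simp add: abs_mult mult_left_le_one_le)
qed auto

lemma continuous_on_quad_flow: "continuous_on S (\<lambda>s. quad M (flow A x (s - a)))"
proof -
  have "continuous_on S (\<lambda>s. flow A x (s - a))"
    by (intro continuous_on_compose2[OF continuous_on_flow[of UNIV]] continuous_intros) auto
  then show ?thesis
    by (intro continuous_on_inner bounded_linear.continuous_on[OF matrix_vector_mul_bounded_linear])
qed

text \<open>As \<open>n\<close> grows, the truncation tends to the indicator of the zeros of
  \<open>M *v flow A x s\<close>, a finite set. Unit vectors violating the bound for every
  \<open>n\<close> would accumulate at some \<open>l\<close>, and dominated convergence along them
  would give an integral of 0 where at least \<open>\<mu>\<close> is required.\<close>

lemma uniform_observability_sphere:
  fixes A M :: "real ^ 'n ^ 'n"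
  assumes sym: "\<And>x y. inner x (M *v y) = inner y (M *v x)" and psd: "\<And>x. quad M x \<ge> 0"
    and obs: "\<And>x. (\<And>t. t \<ge> 0 \<Longrightarrow> M *v flow A x t = 0) \<Longrightarrow> x = 0"
    and \<mu>: "\<mu> > 0"
  shows "\<exists>n. \<forall>x. norm x = 1 \<longrightarrow> integral {0..T} (\<lambda>s. max 0 (1 - real (Suc n) * quad M (flow A x s))) < \<mu>"
proof (rule ccontr)
  assume "\<not> ?thesis"
  then have "\<forall>n. \<exists>x. norm x = 1 \<and>
      integral {0..T} (\<lambda>s. max 0 (1 - real (Suc n) * quad M (flow A x s))) \<ge> \<mu>"
    by (meson not_less)
  from choice[OF this] obtain X where X: "\<And>n. norm (X n) = 1"
    "\<And>n. integral {0..T} (\<lambda>s. max 0 (1 - real (Suc n) * quad M (flow A (X n) s))) \<ge> \<mu>"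
    by blast
  have "seq_compact (sphere (0 :: real ^ 'n) 1)"
    unfolding compact_eq_seq_compact_metric[symmetric] by (rule compact_sphere)
  moreover have "\<forall>n. X n \<in> sphere 0 1" using X(1) by simp
  ultimately obtain l r where l: "l \<in> sphere 0 1" and r: "strict_mono r" "(X \<circ> r) \<longlonglongrightarrow> l"
    unfolding seq_compact_def by blast
  have "l \<noteq> 0" using l by auto
  then obtain t0 where t0: "M *v flow A l t0 \<noteq> 0" using obs by blast
  define Z where "Z = {s \<in> {0..T}. M *v flow A l s = 0}"
  have Z: "negligible Z" unfolding Z_def by (intro negligible_finite finite_zeros_flow[OF t0])
  define g where "g k s = max 0 (1 - real (Suc (r k)) * quad M (flow A (X (r k)) s))" for k s
  define h where "h k s = (if s \<in> Z then 0 else g k s)" for k s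
  have cont: "continuous_on {0..T} (g k)" for k
    unfolding g_def
    by (intro continuous_on_max continuous_on_diff continuous_on_mult_left continuous_on_const
      continuous_on_quad_flow[where a = 0, simplified])
  have gi: "g k integrable_on {0..T}" for k by (rule integrable_continuous_real[OF cont])
  have hi: "h k integrable_on {0..T}" for k
    by (rule integrable_spike[OF gi Z]) (simp add: h_def)
  have hg: "integral {0..T} (h k) = integral {0..T} (g k)" for k
    by (rule integral_spike[OF Z]) (simp add: h_def)
  have lim: "(\<lambda>k. h k s) \<longlonglongrightarrow> 0" if s: "s \<in> {0..T}" for s
  proof (cases "s \<in> Z")
    case True
    then show ?thesis by (simp add: h_def)
  next
    case False
    define q where "q = quad M (flow A l s)"
    have "q \<noteq> 0" using False s psd_kernel[OF sym psd] unfolding q_def Z_def by auto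
    then have q: "q > 0" using psd[of "flow A l s"] by (simp add: q_def)
    have "bounded_linear (\<lambda>x. flow A x s)"
      using linear_flow linear_conv_bounded_linear by blast
    from bounded_linear.tendsto[OF this r(2)]
    have fl: "(\<lambda>k. flow A (X (r k)) s) \<longlonglongrightarrow> flow A l s"
      by (simp add: o_def)
    have lq: "(\<lambda>k. quad M (flow A (X (r k)) s)) \<longlonglongrightarrow> q"
      unfolding q_def
      by (rule tendsto_inner[OF fl bounded_linear.tendsto[OF matrix_vector_mul_bounded_linear fl]])
    have e1: "eventually (\<lambda>k. quad M (flow A (X (r k)) s) > q / 2) sequentially"
      using order_tendstoD(1)[OF lq, of "q / 2"] q by simp
    have e2: "eventually (\<lambda>k. real k \<ge> 2 / q) sequentially"
      using filterlim_real_sequentially unfolding filterlim_at_top by blast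
    show ?thesis
    proof (rule tendsto_eventually)
      show "eventually (\<lambda>k. h k s = 0) sequentially"
        using e1 e2
      proof eventually_elim
        case (elim k)
        \<comment> \<open>The thresholds \<open>2 / q\<close> and \<open>q / 2\<close> multiply to
          1, so the truncation is exactly 0 from some index on.\<close>
        have "real (Suc (r k)) \<ge> 2 / q" using elim(2) seq_suble[OF r(1), of k] by linarith
        then have "real (Suc (r k)) * quad M (flow A (X (r k)) s) \<ge> 2 / q * (q / 2)"
          using elim(1) q by (intro mult_mono) auto
        then show ?case using q by (simp add: h_def g_def)
      qed
    qed
  qed
  have "(\<lambda>k. integral {0..T} (h k)) \<longlonglongrightarrow> integral {0..T} (\<lambda>s. 0)"
  proof (rule dominated_convergence(2)[OF hi _ _ lim])
    show "(\<lambda>s. 1 :: real) integrable_on {0..T}" by (rule integrable_const_ivl)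
    show "norm (h k s) \<le> 1" for k s
      using psd[of "flow A (X (r k)) s"] by (auto simp: h_def g_def)
  qed
  moreover have "integral {0..T} (h k) \<ge> \<mu>" for k
    unfolding hg unfolding g_def by (rule X)
  ultimately have "\<mu> \<le> integral {0..T} (\<lambda>s. 0 :: real)"
    by (intro LIMSEQ_le_const) auto
  then show False using \<mu> by simp
qed

text \<open>Integrating \<open>\<alpha> - g \<le> N * (\<alpha> * q)\<close> leaves at least
  \<open>\<mu> / 2\<close> on the left, since \<open>g\<close> uses up less than half of the mass.
  The resulting \<open>\<delta> = \<mu> / (2 * N)\<close> depends on neither the signal nor the
  start \<open>a\<close>: the flow is autonomous, so the window can be shifted to 0, and homogeneity
  reduces \<open>x\<close> to the unit sphere.\<close>

lemma uniform_observability: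
  fixes A M :: "real ^ 'n ^ 'n"
  assumes sym: "\<And>x y. inner x (M *v y) = inner y (M *v x)" and psd: "\<And>x. quad M x \<ge> 0"
    and obs: "\<And>x. (\<And>t. t \<ge> 0 \<Longrightarrow> M *v flow A x t = 0) \<Longrightarrow> x = 0"
    and \<mu>: "\<mu> > 0"
  obtains \<delta> where "\<delta> > 0"
    "\<And>a \<alpha> x. \<alpha> \<in> borel_measurable (lebesgue_on {a..a + T}) \<Longrightarrow>
      (\<And>s. s \<in> {a..a + T} \<Longrightarrow> \<alpha> s \<in> {0..1}) \<Longrightarrow> \<mu> \<le> integral {a..a + T} \<alpha> \<Longrightarrow>
      \<delta> * (norm x)\<^sup>2 \<le> integral {a..a + T} (\<lambda>s. \<alpha> s * quad M (flow A x (s - a)))"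
proof -
  obtain n where n: "\<And>x. norm x = 1 \<Longrightarrow>
      integral {0..T} (\<lambda>s. max 0 (1 - real (Suc n) * quad M (flow A x s))) < \<mu> / 2"
    using uniform_observability_sphere[OF sym psd obs, where \<mu> = "\<mu> / 2" and T = T] \<mu> by auto
  define N where "N = real (Suc n)"
  have N: "N > 0" by (simp add: N_def)
  show thesis
  proof (rule that[of "\<mu> / (2 * N)"])
    show "\<mu> / (2 * N) > 0" using \<mu> N by simp
    fix a \<alpha> and x :: "real ^ 'n"
    assume \<alpha>: "\<alpha> \<in> borel_measurable (lebesgue_on {a..a + T})"
      "\<And>s. s \<in> {a..a + T} \<Longrightarrow> \<alpha> s \<in> {0..1}" "\<mu> \<le> integral {a..a + T} \<alpha>"
    show "\<mu> / (2 * N) * (norm x)\<^sup>2 \<le> integral {a..a + T} (\<lambda>s. \<alpha> s * quad M (flow A x (s - a)))"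
    proof (cases "x = 0")
      case True
      then show ?thesis using linear_0[OF linear_flow[of A]] by simp
    next
      case False
      define v where "v = x /\<^sub>R norm x"
      have v: "norm v = 1" "x = norm x *\<^sub>R v" using False by (simp_all add: v_def)
      define q where "q s = quad M (flow A v (s - a))" for s
      define g where "g s = max 0 (1 - N * q s)" for s
      have cq: "continuous_on {a..a + T} q" unfolding q_def by (rule continuous_on_quad_flow)
      have cg: "continuous_on {a..a + T} g" unfolding g_def by (intro continuous_intros cq)
      have ig: "integral {a..a + T} g < \<mu> / 2"
      proof -
        have "integral {a..a + T} g = integral {0..T} (g \<circ> (+) a)"
          using integral_shift_Icc_real[of 0 T g a] by (simp add: add.commute)
        also have "\<dots> = integral {0..T} (\<lambda>s. max 0 (1 - N * quad M (flow A v s)))"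
          by (simp add: o_def g_def q_def)
        finally show ?thesis using n[OF v(1)] by (simp add: N_def)
      qed
      have \<alpha>i: "\<alpha> integrable_on {a..a + T}"
        using integrable_times_continuous[OF \<alpha>(1,2), of "\<lambda>_. 1"] by simp
      have \<alpha>q: "(\<lambda>s. \<alpha> s * q s) integrable_on {a..a + T}"
        by (rule integrable_times_continuous[OF \<alpha>(1,2) cq])
      have gi: "g integrable_on {a..a + T}" by (rule integrable_continuous_real[OF cg])
      have "\<mu> / 2 \<le> integral {a..a + T} \<alpha> - integral {a..a + T} g"
        using \<alpha>(3) ig by simp
      also have "\<dots> = integral {a..a + T} (\<lambda>s. \<alpha> s - g s)"
        by (rule integral_diff[symmetric, OF \<alpha>i gi])
      also have "\<dots> \<le> integral {a..a + T} (\<lambda>s. N * (\<alpha> s * q s))"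
      proof (rule integral_le)
        show "(\<lambda>s. \<alpha> s - g s) integrable_on {a..a + T}" by (rule integrable_diff[OF \<alpha>i gi])
        show "(\<lambda>s. N * (\<alpha> s * q s)) integrable_on {a..a + T}"
          using \<alpha>q by (rule integrable_on_mult_right)
        fix s assume s: "s \<in> {a..a + T}"
        have "\<alpha> s * (1 - g s) \<le> \<alpha> s * (N * q s)"
          using \<alpha>(2)[OF s] by (intro mult_left_mono) (auto simp: g_def)
        moreover have "\<alpha> s * g s \<le> g s"
          using \<alpha>(2)[OF s] by (intro mult_left_le_one_le) (auto simp: g_def)
        ultimately show "\<alpha> s - g s \<le> N * (\<alpha> s * q s)" by (simp add: algebra_simps)
      qed
      also have "\<dots> = N * integral {a..a + T} (\<lambda>s. \<alpha> s * q s)" by simp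
      finally have main: "\<mu> / (2 * N) \<le> integral {a..a + T} (\<lambda>s. \<alpha> s * q s)"
        using N by (simp add: field_simps)
      have "flow A x t = norm x *\<^sub>R flow A v t" for t
        using linear_cmul[OF linear_flow[of A t], of "norm x" v] v(2) by simp
      then have "quad M (flow A x (s - a)) = (norm x)\<^sup>2 * q s" for s
        by (simp add: q_def power2_eq_square matrix_vector_mult_scaleR)
      then have "integral {a..a + T} (\<lambda>s. \<alpha> s * quad M (flow A x (s - a))) =
          (norm x)\<^sup>2 * integral {a..a + T} (\<lambda>s. \<alpha> s * q s)"
        by (simp add: mult.left_commute[of _ "(norm x)\<^sup>2"])
      then show ?thesis using mult_left_mono[OF main, of "(norm x)\<^sup>2"] by (simp add: mult_ac)
    qed
  qed
qed

section \<open>Quadratic forms along absolutely continuous curves\<close>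

text \<open>The difference quotient at \<open>s\<close> is at most
  \<open>C * \<bar>t - s\<bar>\<close>, so the derivative exists everywhere and is 0.\<close>

lemma constant_if_quadratic_increments:
  fixes W :: "real \<Rightarrow> real"
  assumes "a \<le> b" and W: "\<And>s t. a \<le> s \<Longrightarrow> s \<le> t \<Longrightarrow> t \<le> b \<Longrightarrow> \<bar>W t - W s\<bar> \<le> C * (t - s)\<^sup>2"
  shows "W b = W a"
proof -
  have "(W has_field_derivative 0) (at s within {a..b})" if s: "s \<in> {a..b}" for s
    unfolding has_field_derivative_iff
  proof (rule Lim_null_comparison)
    show "((\<lambda>t. C * \<bar>t - s\<bar>) \<longlongrightarrow> 0) (at s within {a..b})"
      by (auto intro!: tendsto_eq_intros)
    show "eventually (\<lambda>t. norm ((W t - W s) / (t - s)) \<le> C * \<bar>t - s\<bar>) (at s within {a..b})"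
      unfolding eventually_at_filter
    proof (intro always_eventually allI impI)
      fix t assume t: "t \<noteq> s" "t \<in> {a..b}"
      have "\<bar>W t - W s\<bar> \<le> C * (t - s)\<^sup>2"
        using W[of s t] W[of t s] s t by (cases "s \<le> t") (auto simp: abs_minus_commute power2_commute)
      then have "\<bar>W t - W s\<bar> / \<bar>t - s\<bar> \<le> C * (t - s)\<^sup>2 / \<bar>t - s\<bar>"
        by (intro divide_right_mono) auto
      also have "\<dots> = C * \<bar>t - s\<bar>" using t by (simp add: power2_eq_square abs_mult_self_eq[of "t - s", symmetric] del: abs_mult_self_eq)
      finally show "norm ((W t - W s) / (t - s)) \<le> C * \<bar>t - s\<bar>" by (simp add: abs_divide)
    qed
  qed
  then obtain c where "\<forall>s\<in>{a..b}. W s = c"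
    using has_field_derivative_zero_constant[of "{a..b}" W] by auto
  then show ?thesis using \<open>a \<le> b\<close> by simp
qed

lemma norm_integral_le_const:
  fixes f :: "real \<Rightarrow> 'a::banach"
  assumes "s \<le> t" "f integrable_on {s..t}" "\<And>r. r \<in> {s..t} \<Longrightarrow> norm (f r) \<le> B"
  shows "norm (integral {s..t} f) \<le> B * (t - s)"
  using integral_norm_bound_integral[of f "{s..t}" "\<lambda>_. B"] assms integrable_const_ivl[of B s t] by (simp add: mult.commute)

text \<open>The difference of both sides has increments of quadratic order, hence it is constant. This avoids
  differentiating \<open>x\<close>, which exists only almost everywhere.\<close>
lemma quad_integral:
  fixes P :: "real ^ 'n ^ 'n" and x g :: "real \<Rightarrow> real ^ 'n"
  assumes P: "pos_def P" and ab: "a \<le> b" and cx: "continuous_on {a..b} x"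
    and gi: "g absolutely_integrable_on {a..b}" and gL: "\<And>s. s \<in> {a..b} \<Longrightarrow> norm (g s) \<le> L"
    and xg: "\<And>t. t \<in> {a..b} \<Longrightarrow> x t = x a + integral {a..t} g"
  shows "(\<lambda>s. inner (x s) (P *v g s)) integrable_on {a..b}"
    and "quad P (x b) = quad P (x a) + 2 * integral {a..b} (\<lambda>s. inner (x s) (P *v g s))"
proof -
  let ?w = "\<lambda>s. inner (x s) (P *v g s)"
  define W where "W t = quad P (x t) - 2 * integral {a..t} ?w" for t
  have L: "L \<ge> 0" using gL[of a] ab norm_ge_zero[of "g a"] by (simp add: order_trans[OF norm_ge_zero])
  have giI: "g integrable_on {a..b}" using gi set_lebesgue_integral_eq_integral(1) by blast
  have "bilinear (\<lambda>u v. inner u (P *v v))"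
    unfolding bilinear_def
    by (auto intro!: linearI simp: inner_add_left inner_add_right matrix_vector_right_distrib matrix_vector_mult_scaleR)
  then have "?w absolutely_integrable_on {a..b}"
  proof (rule absolutely_integrable_bounded_measurable_product)
    show "x \<in> borel_measurable (lebesgue_on {a..b})"
      by (rule continuous_imp_measurable_on_sets_lebesgue[OF cx]) simp
    show "bounded (x ` {a..b})"
      by (intro compact_imp_bounded compact_continuous_image cx) simp
  qed (use gi in auto)
  then show wi: "?w integrable_on {a..b}" using set_lebesgue_integral_eq_integral(1) by blast
  have sub: "f integrable_on {s..t}" if "f integrable_on {a..b}" "a \<le> s" "t \<le> b" for f :: "real \<Rightarrow> 'c::banach" and s t
    using that by (meson integrable_on_subinterval atLeastatMost_subset_iff)
  have inc: "x t - x s = integral {s..t} g" if "a \<le> s" "s \<le> t" "t \<le> b" for s t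
  proof -
    have "x t - x s = integral {a..t} g - integral {a..s} g"
      using xg[of s] xg[of t] that by simp
    also have "integral {a..t} g = integral {a..s} g + integral {s..t} g"
      using that sub[OF giI, of a t] Henstock_Kurzweil_Integration.integral_combine[where a = a and c = s and b = t and f = g] by simp
    finally show ?thesis by simp
  qed
  have lip: "norm (x t - x s) \<le> L * (t - s)" if "a \<le> s" "s \<le> t" "t \<le> b" for s t
  proof -
    have "norm (integral {s..t} g) \<le> L * (t - s)"
      by (rule norm_integral_le_const) (use that gL sub[OF giI] in auto)
    then show ?thesis using inc[OF that] by simp
  qed
  define C where "C = L * (onorm ((*v) P) * (2 * L))"
  have "W b = W a"
  proof (rule constant_if_quadratic_increments[OF ab])
    fix s t assume st: "a \<le> s" "s \<le> t" "t \<le> b"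
    let ?v = "x t + x s"
    have gst: "g integrable_on {s..t}" and wst: "?w integrable_on {s..t}"
      using st by (auto intro: sub[OF giI] sub[OF wi])
    have bl: "bounded_linear (\<lambda>u. inner u (P *v ?v))" by (rule bounded_linear_inner_left)
    \<comment> \<open>By symmetry of \<open>P\<close> the difference of squares factors into
      increment and sum.\<close>
    have "quad P (x t) - quad P (x s) = inner (x t - x s) (P *v ?v)"
      using pos_def_sym[OF P, of "x t" "x s"]
      by (simp add: inner_diff_left inner_add_right matrix_vector_right_distrib)
    also have "\<dots> = integral {s..t} (\<lambda>r. inner (g r) (P *v ?v))"
      unfolding inc[OF st] using integral_linear[OF gst bl] by (simp add: o_def)
    finally have d1: "quad P (x t) - quad P (x s) = integral {s..t} (\<lambda>r. inner (g r) (P *v ?v))" .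
    have i1: "(\<lambda>r. inner (g r) (P *v ?v)) integrable_on {s..t}"
      using integrable_linear[OF gst bl] by (simp add: o_def)
    have "integral {a..t} ?w - integral {a..s} ?w = integral {s..t} ?w"
      using Henstock_Kurzweil_Integration.integral_combine[where a = a and c = s and b = t and f = ?w] st sub[OF wi, of a t] by auto
    then have "W t - W s = integral {s..t} (\<lambda>r. inner (g r) (P *v ?v)) - integral {s..t} (\<lambda>r. 2 * ?w r)"
      using d1 by (simp add: W_def)
    also have "\<dots> = integral {s..t} (\<lambda>r. inner (g r) (P *v ?v) - 2 * ?w r)"
      by (rule integral_diff[symmetric]) (use i1 wst in \<open>auto intro: integrable_on_mult_right\<close>)
    finally have d2: "W t - W s = integral {s..t} (\<lambda>r. inner (g r) (P *v ?v) - 2 * ?w r)" .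
    have "norm (integral {s..t} (\<lambda>r. inner (g r) (P *v ?v) - 2 * ?w r)) \<le> (C * (t - s)) * (t - s)"
    proof (rule norm_integral_le_const)
      show "s \<le> t" by fact
    next
      fix r assume r: "r \<in> {s..t}"
      \<comment> \<open>Comparing \<open>x t + x s\<close> with \<open>2 * x r\<close> leaves two
        increments of the Lipschitz curve \<open>x\<close>. The integrand is thus of order
        \<open>t - s\<close>, and integration supplies the second factor.\<close>
      have "inner (g r) (P *v ?v) - 2 * ?w r = inner (g r) (P *v ((x t - x r) - (x r - x s)))"
        unfolding inner_add_right inner_diff_right matrix_vector_right_distrib matrix_vector_mult_diff_distrib
          pos_def_sym[OF P, of "x r" "g r"] by simp
      also have "norm \<dots> \<le> norm (g r) * norm (P *v ((x t - x r) - (x r - x s)))"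
        unfolding real_norm_def by (rule Cauchy_Schwarz_ineq2)
      also have "\<dots> \<le> L * (onorm ((*v) P) * (2 * L * (t - s)))"
      proof (rule mult_mono)
        show "norm (g r) \<le> L" using gL r st by auto
        have "norm ((x t - x r) - (x r - x s)) \<le> L * (t - r) + L * (r - s)"
          using norm_triangle_ineq4[of "x t - x r" "x r - x s"] lip[of r t] lip[of s r] r st by auto
        also have "\<dots> \<le> 2 * L * (t - s)"
          using L r st mult_left_mono[of 0 "t - s" L] by (simp add: algebra_simps)
        finally show "norm (P *v ((x t - x r) - (x r - x s))) \<le> onorm ((*v) P) * (2 * L * (t - s))"
          by (meson norm_matrix_vector_le order_trans mult_left_mono onorm_matrix_nonneg)
      qed (use L in auto)
      finally show "norm (inner (g r) (P *v ?v) - 2 * ?w r) \<le> C * (t - s)"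
        by (simp add: C_def mult.assoc)
    next
      show "(\<lambda>r. inner (g r) (P *v ?v) - 2 * ?w r) integrable_on {s..t}"
        by (intro integrable_diff i1 integrable_on_mult_right wst)
    qed
    then show "\<bar>W t - W s\<bar> \<le> C * (t - s)\<^sup>2" by (simp add: d2 power2_eq_square mult.assoc)
  qed
  then show "quad P (x b) = quad P (x a) + 2 * integral {a..b} ?w" by (simp add: W_def)
qed

section \<open>Trajectories of the damped system\<close>

text \<open>This form covers the right-hand side of the closed loop as well as that of the error
  equation. The bound \<open>L\<close> is the Lipschitz constant asked for by
  \<open>quad_integral\<close>.\<close>

lemma absolutely_integrable_controlled:
  fixes h k :: "real \<Rightarrow> real ^ 'n"
  assumes \<alpha>: "\<alpha> \<in> borel_measurable (lebesgue_on {a..b})" "\<And>s. s \<in> {a..b} \<Longrightarrow> \<alpha> s \<in> {0..1}"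
    and h: "continuous_on {a..b} h" and k: "continuous_on {a..b} k"
  shows "\<exists>L. (\<lambda>s. h s - \<alpha> s *\<^sub>R k s) absolutely_integrable_on {a..b} \<and>
    (\<forall>s\<in>{a..b}. norm (h s - \<alpha> s *\<^sub>R k s) \<le> L)"
proof -
  have "bounded (h ` {a..b})" "bounded (k ` {a..b})"
    by (intro compact_imp_bounded compact_continuous_image h k compact_Icc)+
  then obtain L1 L2 where "\<forall>v\<in>h ` {a..b}. norm v \<le> L1" "\<forall>v\<in>k ` {a..b}. norm v \<le> L2"
    unfolding bounded_iff by blast
  then have L: "norm (h s) \<le> L1" "norm (k s) \<le> L2" if "s \<in> {a..b}" for s
    using that by auto
  have bd: "norm (h s - \<alpha> s *\<^sub>R k s) \<le> L1 + L2" if s: "s \<in> {a..b}" for s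
  proof -
    have "norm (\<alpha> s *\<^sub>R k s) \<le> norm (k s)"
      using \<alpha>(2)[OF s] by (simp add: mult_left_le_one_le)
    then show ?thesis using norm_triangle_ineq4[of "h s" "\<alpha> s *\<^sub>R k s"] L[OF s] by linarith
  qed
  have "(\<lambda>s. h s - \<alpha> s *\<^sub>R k s) absolutely_integrable_on {a..b}"
  proof (rule measurable_bounded_by_integrable_imp_absolutely_integrable)
    show "(\<lambda>s. h s - \<alpha> s *\<^sub>R k s) \<in> borel_measurable (lebesgue_on {a..b})"
      by (intro borel_measurable_diff borel_measurable_scaleR \<alpha> continuous_imp_measurable_on_sets_lebesgue h k) auto
    show "(\<lambda>s. L1 + L2) integrable_on {a..b}" by (rule integrable_const_ivl)
  qed (use bd in auto)
  then show ?thesis using bd by blast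
qed

text \<open>\<open>G\<close> is the adjoint of \<open>B\<close> for the inner product of
  \<open>P\<close>, that is \<open>transpose B ** P\<close>, and the feedback is \<open>- G\<close>.
  The estimates along trajectories rest on these identities and not on the formula for
  \<open>M\<close>.\<close>

locale damped_system =
  fixes A P M :: "real ^ 'n ^ 'n" and B :: "real ^ 'm ^ 'n" and G :: "real ^ 'n ^ 'm"
  assumes P: "pos_def P"
    and dissipative: "\<And>x. inner x (P *v (A *v x)) \<le> 0"
    and adjoint: "\<And>u v. inner u (P *v (B *v v)) = inner (G *v u) v"
    and M_sym: "\<And>x y. inner x (M *v y) = inner y (M *v x)"
    and M_form: "\<And>x. quad M x = 2 * (norm (G *v x))\<^sup>2 - 2 * inner x (P *v (A *v x))"
begin

lemma output_le_M: "2 * (norm (G *v x))\<^sup>2 \<le> quad M x"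
  using M_form[of x] dissipative[of x] by simp

lemma M_nonneg: "quad M x \<ge> 0"
  using output_le_M[of x] zero_le_power2[of "norm (G *v x)"] by linarith

end

text \<open>A closed loop solution seen on one window, with the integral equation based at the left
  end \<open>a\<close>, so that windows can be chained. The type variable \<open>'a\<close> is the
  state index, called \<open>'n\<close> in \<open>damped_system\<close>.\<close>

locale damped_trajectory = damped_system +
  fixes \<alpha> :: "real \<Rightarrow> real" and a b :: real and x :: "real \<Rightarrow> real ^ 'a"
  assumes ab: "a \<le> b"
    and \<alpha>_meas: "\<alpha> \<in> borel_measurable (lebesgue_on {a..b})"
    and \<alpha>_range: "\<And>s. s \<in> {a..b} \<Longrightarrow> \<alpha> s \<in> {0..1}"
    and cont: "continuous_on {a..b} x"
    and integral_eq: "\<And>t. t \<in> {a..b} \<Longrightarrow>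
      x t = x a + integral {a..t} (\<lambda>s. A *v x s - \<alpha> s *\<^sub>R (B *v (G *v x s)))"
begin

lemma integrable_M: "(\<lambda>s. \<alpha> s * quad M (x s)) integrable_on {a..b}"
  by (intro integrable_times_continuous \<alpha>_meas \<alpha>_range continuous_on_inner continuous_on_matrix_vector cont)

lemma storage_decrease:
  "quad P (x b) \<le> quad P (x a) - integral {a..b} (\<lambda>s. \<alpha> s * quad M (x s))"
proof -
  let ?g = "\<lambda>s. A *v x s - \<alpha> s *\<^sub>R (B *v (G *v x s))"
  have "\<exists>L. ?g absolutely_integrable_on {a..b} \<and> (\<forall>s\<in>{a..b}. norm (?g s) \<le> L)"
    by (rule absolutely_integrable_controlled) (use \<alpha>_meas \<alpha>_range in \<open>auto intro!: continuous_on_matrix_vector cont\<close>)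
  then obtain L where g: "?g absolutely_integrable_on {a..b}" "\<And>s. s \<in> {a..b} \<Longrightarrow> norm (?g s) \<le> L"
    by blast
  note q = quad_integral[OF P ab cont g integral_eq]
  have "integral {a..b} (\<lambda>s. 2 * inner (x s) (P *v ?g s)) \<le> integral {a..b} (\<lambda>s. - (\<alpha> s * quad M (x s)))"
  proof (rule integral_le)
    show "(\<lambda>s. 2 * inner (x s) (P *v ?g s)) integrable_on {a..b}"
      using q(1) by (rule integrable_on_mult_right)
    show "(\<lambda>s. - (\<alpha> s * quad M (x s))) integrable_on {a..b}"
      using integrable_M by (rule integrable_neg)
    fix s assume s: "s \<in> {a..b}"
    have i: "inner (x s) (P *v ?g s) = inner (x s) (P *v (A *v x s)) - \<alpha> s * (norm (G *v x s))\<^sup>2"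
      by (simp add: matrix_vector_mult_diff_distrib matrix_vector_mult_scaleR inner_diff_right adjoint power2_norm_eq_inner)
    \<comment> \<open>The share of \<open>A\<close> is nonpositive and
      \<open>\<alpha> s \<le> 1\<close>, so it may be weighted by \<open>\<alpha> s\<close>; both
      shares then combine into \<open>M\<close>.\<close>
    have "inner (x s) (P *v (A *v x s)) \<le> \<alpha> s * inner (x s) (P *v (A *v x s))"
      using \<alpha>_range[OF s] dissipative[of "x s"] mult_right_mono_neg[of "\<alpha> s" 1] by simp
    then show "2 * inner (x s) (P *v ?g s) \<le> - (\<alpha> s * quad M (x s))"
      unfolding i M_form by (simp add: algebra_simps)
  qed
  then show ?thesis using q(2) by simp
qed

lemma restrict:
  assumes t: "a \<le> t" "t \<le> b"
  shows "damped_trajectory A P M B G \<alpha> a t x"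
proof
  have sub: "{a..t} \<subseteq> {a..b}" using t by simp
  show "a \<le> t" by (rule t(1))
  show "\<alpha> \<in> borel_measurable (lebesgue_on {a..t})"
    by (rule measurable_restrict_mono[OF \<alpha>_meas sub])
  show "continuous_on {a..t} x" by (rule continuous_on_subset[OF cont sub])
  show "\<alpha> s \<in> {0..1}" if "s \<in> {a..t}" for s
    using \<alpha>_range sub that by blast
  show "x s = x a + integral {a..s} (\<lambda>s. A *v x s - \<alpha> s *\<^sub>R (B *v (G *v x s)))" if "s \<in> {a..t}" for s
    using integral_eq sub that by blast
qed

lemma M_quad_nonneg: "s \<in> {a..b} \<Longrightarrow> 0 \<le> \<alpha> s * quad M (x s)"
  using \<alpha>_range M_nonneg by simp

lemma integral_M_mono:
  assumes "a \<le> t" "t \<le> b"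
  shows "0 \<le> integral {a..t} (\<lambda>s. \<alpha> s * quad M (x s))"
    and "integral {a..t} (\<lambda>s. \<alpha> s * quad M (x s)) \<le> integral {a..b} (\<lambda>s. \<alpha> s * quad M (x s))"
proof -
  interpret sub: damped_trajectory A P M B G \<alpha> a t x by (rule restrict[OF assms])
  show "0 \<le> integral {a..t} (\<lambda>s. \<alpha> s * quad M (x s))"
    by (rule integral_nonneg[OF sub.integrable_M sub.M_quad_nonneg])
  show "integral {a..t} (\<lambda>s. \<alpha> s * quad M (x s)) \<le> integral {a..b} (\<lambda>s. \<alpha> s * quad M (x s))"
  proof (rule integral_subset_le[OF _ sub.integrable_M integrable_M])
    show "{a..t} \<subseteq> {a..b}" using assms by simp
    show "\<forall>s\<in>{a..b}. 0 \<le> \<alpha> s * quad M (x s)" using M_quad_nonneg by blast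
  qed
qed

lemma storage_le:
  assumes "a \<le> t" "t \<le> b"
  shows "quad P (x t) \<le> quad P (x a)"
  using damped_trajectory.storage_decrease[OF restrict[OF assms]] integral_M_mono(1)[OF assms] by linarith

text \<open>The factor 4 bounds the storage of the difference by the parallelogram law, and \<open>\<theta>\<close> is
  the weight in Young's inequality.\<close>
lemma distance_to_flow:
  assumes \<theta>: "\<theta> > 0" and \<beta>: "\<And>u. (norm (G *v u))\<^sup>2 \<le> \<beta> * quad P u" "\<beta> \<ge> 0" and t: "a \<le> t" "t \<le> b"
  shows "quad P (x t - flow A (x a) (t - a)) \<le>
    4 * \<theta> * \<beta> * (b - a) * quad P (x a) + integral {a..b} (\<lambda>s. \<alpha> s * quad M (x s)) / (2 * \<theta>)"
proof -
  define y where "y s = flow A (x a) (s - a)" for s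
  define e where "e s = x s - y s" for s
  define V where "V = quad P (x a)"
  let ?g = "\<lambda>s. A *v e s - \<alpha> s *\<^sub>R (B *v (G *v x s))"
  let ?f = "\<lambda>s. A *v x s - \<alpha> s *\<^sub>R (B *v (G *v x s))"
  interpret sub: damped_trajectory A P M B G \<alpha> a t x by (rule restrict[OF t])
  have y': "(y has_vector_derivative A *v y s) (at s within S)" for s S
  proof -
    have "((\<lambda>s. s - a) has_vector_derivative 1) (at s within S)"
      unfolding has_real_derivative_iff_has_vector_derivative[symmetric] by (auto intro!: derivative_eq_intros)
    from vector_diff_chain_within[OF this has_vector_derivative_flow, of A "x a"]
    show ?thesis by (simp add: o_def y_def[abs_def])
  qed
  have cy: "continuous_on S y" for S by (rule continuous_on_vector_derivative[OF y'])
  have ce: "continuous_on {a..t} e" unfolding e_def by (intro continuous_on_diff sub.cont cy)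
  have "\<exists>L. ?g absolutely_integrable_on {a..t} \<and> (\<forall>s\<in>{a..t}. norm (?g s) \<le> L)"
    by (rule absolutely_integrable_controlled) (use sub.\<alpha>_meas sub.\<alpha>_range in \<open>auto intro!: continuous_on_matrix_vector sub.cont ce\<close>)
  then obtain L where g: "?g absolutely_integrable_on {a..t}" "\<And>s. s \<in> {a..t} \<Longrightarrow> norm (?g s) \<le> L"
    by blast
  have "\<exists>L. ?f absolutely_integrable_on {a..t} \<and> (\<forall>s\<in>{a..t}. norm (?f s) \<le> L)"
    by (rule absolutely_integrable_controlled) (use sub.\<alpha>_meas sub.\<alpha>_range in \<open>auto intro!: continuous_on_matrix_vector sub.cont ce\<close>)
  then obtain L' where f: "?f absolutely_integrable_on {a..t}" "\<And>s. s \<in> {a..t} \<Longrightarrow> norm (?f s) \<le> L'"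
    by blast
  have e0: "e a = 0" by (simp add: e_def y_def)
  \<comment> \<open>Subtracting the two integral equations shows that the error obeys
    \<open>A\<close> and is driven only by the output \<open>G *v x s\<close> of the true
    trajectory, which the dissipation controls.\<close>
  have ge: "e r = e a + integral {a..r} ?g" if r: "r \<in> {a..t}" for r
  proof -
    have yi: "((\<lambda>s. A *v y s) has_integral y r - y a) {a..r}"
      using r y' by (intro fundamental_theorem_of_calculus) auto
    have "?f integrable_on {a..t}" using f(1) set_lebesgue_integral_eq_integral(1) by blast
    then have fi: "?f integrable_on {a..r}" using r by (auto intro: integrable_on_subinterval)
    have "integral {a..r} ?g = integral {a..r} (\<lambda>s. ?f s - A *v y s)"
      by (rule integral_cong) (simp add: e_def matrix_vector_mult_diff_distrib)
    also have "\<dots> = integral {a..r} ?f - (y r - y a)"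
      using has_integral_diff[OF integrable_integral[OF fi] yi] by (rule integral_unique)
    finally have i: "integral {a..r} ?g = integral {a..r} ?f - (y r - y a)" .
    have "e r = x a + integral {a..r} ?f - y r"
      unfolding e_def by (subst sub.integral_eq[OF r]) (rule refl)
    then show ?thesis unfolding i by (simp add: e_def)
  qed
  note q = quad_integral[OF P t(1) ce g ge]
  have V: "0 \<le> V" unfolding V_def by (rule pos_def_nonneg[OF P])
  let ?b = "\<lambda>s. 4 * \<theta> * \<beta> * V + (\<alpha> s * quad M (x s)) / (2 * \<theta>)"
  have Mi: "(\<lambda>s. (\<alpha> s * quad M (x s)) / (2 * \<theta>)) integrable_on {a..t}"
    by (rule integrable_on_divide[OF sub.integrable_M])
  have "integral {a..t} (\<lambda>s. 2 * inner (e s) (P *v ?g s)) \<le> integral {a..t} ?b"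
  proof (rule integral_le)
    show "(\<lambda>s. 2 * inner (e s) (P *v ?g s)) integrable_on {a..t}"
      using q(1) by (rule integrable_on_mult_right)
    show "?b integrable_on {a..t}"
      by (intro integrable_add integrable_const_ivl Mi)
    fix s assume s: "s \<in> {a..t}"
    then have \<alpha>s: "0 \<le> \<alpha> s" "\<alpha> s \<le> 1" using sub.\<alpha>_range by auto
    define p where "p = norm (G *v e s)"
    define w where "w = norm (G *v x s)"
    have "quad P (e s) \<le> 2 * quad P (x s) + 2 * quad P (y s)"
      unfolding e_def by (rule quad_diff_le[OF pos_def_sym[OF P] pos_def_nonneg[OF P]])
    moreover have "quad P (y s) \<le> V"
      unfolding y_def V_def using s by (intro quad_flow_le P dissipative) auto
    moreover have "quad P (x s) \<le> V"
      unfolding V_def using s by (intro sub.storage_le) auto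
    ultimately have "quad P (e s) \<le> 4 * V" by linarith
    then have p: "p\<^sup>2 \<le> \<beta> * (4 * V)"
      unfolding p_def using \<beta> by (meson mult_left_mono order_trans)
    have "2 * (p * w) \<le> \<theta> * p\<^sup>2 + w\<^sup>2 / \<theta>"
    proof -
      have "0 \<le> (\<theta> * p - w)\<^sup>2 / \<theta>" using \<theta> by simp
      also have "\<dots> = \<theta> * p\<^sup>2 + w\<^sup>2 / \<theta> - 2 * (p * w)"
        using \<theta> by (simp add: field_simps power2_eq_square)
      finally show ?thesis by simp
    qed
    also have "\<dots> \<le> \<theta> * (\<beta> * (4 * V)) + quad M (x s) / 2 / \<theta>"
      using p \<theta> output_le_M[of "x s"] by (intro add_mono mult_left_mono divide_right_mono) (auto simp: w_def)
    finally have pw: "2 * (p * w) \<le> \<theta> * (\<beta> * (4 * V)) + quad M (x s) / 2 / \<theta>" .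
    \<comment> \<open>The drift is dissipative on the error as well, so only the product of the two
      outputs remains.\<close>
    have "inner (e s) (P *v ?g s) = inner (e s) (P *v (A *v e s)) - \<alpha> s * inner (G *v e s) (G *v x s)"
      by (simp add: matrix_vector_mult_diff_distrib matrix_vector_mult_scaleR inner_diff_right adjoint)
    also have "\<dots> \<le> \<alpha> s * (p * w)"
    proof -
      have "- inner (G *v e s) (G *v x s) \<le> p * w"
        unfolding p_def w_def using Cauchy_Schwarz_ineq2[of "G *v e s" "G *v x s"] by linarith
      then have "\<alpha> s * - inner (G *v e s) (G *v x s) \<le> \<alpha> s * (p * w)"
        using \<alpha>s by (intro mult_left_mono) auto
      then show ?thesis using dissipative[of "e s"] by simp
    qed
    finally have "2 * inner (e s) (P *v ?g s) \<le> \<alpha> s * (2 * (p * w))" by simp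
    also have "\<dots> \<le> \<alpha> s * (\<theta> * (\<beta> * (4 * V)) + quad M (x s) / 2 / \<theta>)"
      using pw \<alpha>s by (intro mult_left_mono) auto
    also have "\<dots> \<le> ?b s"
    proof -
      have "\<alpha> s * (\<theta> * (\<beta> * (4 * V))) \<le> \<theta> * (\<beta> * (4 * V))"
        using \<alpha>s \<theta> \<beta>(2) V by (intro mult_left_le_one_le) auto
      then show ?thesis by (simp add: distrib_left mult_ac)
    qed
    finally show "2 * inner (e s) (P *v ?g s) \<le> ?b s" .
  qed
  moreover have "integral {a..t} ?b = 4 * \<theta> * \<beta> * V * (t - a) + integral {a..t} (\<lambda>s. \<alpha> s * quad M (x s)) / (2 * \<theta>)"
    using t by (subst integral_add[OF integrable_const_ivl Mi]) (simp add: mult_ac)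
  moreover have "4 * \<theta> * \<beta> * V * (t - a) \<le> 4 * \<theta> * \<beta> * V * (b - a)"
    using t \<theta> \<beta>(2) V by (intro mult_left_mono) auto
  moreover have "integral {a..t} (\<lambda>s. \<alpha> s * quad M (x s)) / (2 * \<theta>) \<le> integral {a..b} (\<lambda>s. \<alpha> s * quad M (x s)) / (2 * \<theta>)"
    using integral_M_mono(2)[OF t] \<theta> by (intro divide_right_mono) auto
  moreover have "quad P (e t) = integral {a..t} (\<lambda>s. 2 * inner (e s) (P *v ?g s))"
    using q(2) e0 by simp
  ultimately have "quad P (e t) \<le> 4 * \<theta> * \<beta> * V * (b - a) + integral {a..b} (\<lambda>s. \<alpha> s * quad M (x s)) / (2 * \<theta>)"
    by linarith
  then show ?thesis unfolding e_def y_def V_def by (simp only: mult_ac)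
qed

end

section \<open>Exponential decay\<close>

text \<open>Let \<open>E\<close> be the dissipation over the window. Observability bounds
  \<open>\<delta>' * V\<close> by the dissipation of the free flow, which is at most
  \<open>2 * E\<close> plus the error \<open>2 * (m * R) * T\<close>. The error contains
  \<open>V\<close> again, but with a factor that a small \<open>\<theta>\<close> makes harmless;
  hence \<open>E\<close> is at least a fixed fraction of \<open>V\<close>.\<close>

lemma (in damped_system) window_contraction:
  assumes T: "T > 0" and \<delta>: "\<delta> > 0"
    and obs: "\<And>a \<alpha> v. \<alpha> \<in> borel_measurable (lebesgue_on {a..a + T}) \<Longrightarrow>
      (\<And>s. s \<in> {a..a + T} \<Longrightarrow> \<alpha> s \<in> {0..1}) \<Longrightarrow> \<mu> \<le> integral {a..a + T} \<alpha> \<Longrightarrow>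
      \<delta> * (norm v)\<^sup>2 \<le> integral {a..a + T} (\<lambda>s. \<alpha> s * quad M (flow A v (s - a)))"
  obtains \<rho> where "0 < \<rho>" "\<rho> < 1"
    "\<And>\<alpha> a x. damped_trajectory A P M B G \<alpha> a (a + T) x \<Longrightarrow> \<mu> \<le> integral {a..a + T} \<alpha> \<Longrightarrow>
      quad P (x (a + T)) \<le> \<rho> * quad P (x a)"
proof -
  obtain c C where c: "c > 0" "C > 0" "\<And>x. c * (norm x)\<^sup>2 \<le> quad P x" "\<And>x. quad P x \<le> C * (norm x)\<^sup>2"
    by (rule pos_def_bounds[OF P]) (rule that)
  have norm_le: "(norm u)\<^sup>2 \<le> quad P u / c" for u
    using c(1) c(3)[of u] by (simp add: pos_le_divide_eq mult.commute)
  define \<beta> where "\<beta> = (onorm ((*v) G))\<^sup>2 / c"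
  have \<beta>0: "\<beta> \<ge> 0" using c by (simp add: \<beta>_def)
  have \<beta>: "(norm (G *v u))\<^sup>2 \<le> \<beta> * quad P u" for u
  proof -
    have "(norm (G *v u))\<^sup>2 \<le> (onorm ((*v) G))\<^sup>2 * (norm u)\<^sup>2"
      unfolding power_mult_distrib[symmetric] by (intro power_mono norm_matrix_vector_le) simp
    also have "\<dots> \<le> (onorm ((*v) G))\<^sup>2 * (quad P u / c)"
      by (intro mult_left_mono norm_le) simp
    finally show ?thesis by (simp add: \<beta>_def)
  qed
  define m where "m = onorm ((*v) M) / c"
  have m0: "m \<ge> 0" using c onorm_matrix_nonneg[of M] by (simp add: m_def)
  have m: "quad M u \<le> m * quad P u" for u
  proof -
    have "quad M u \<le> norm u * (onorm ((*v) M) * norm u)"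
      using norm_cauchy_schwarz order_trans mult_left_mono[OF norm_matrix_vector_le norm_ge_zero] by blast
    also have "\<dots> = onorm ((*v) M) * (norm u)\<^sup>2" by (simp add: power2_eq_square)
    also have "\<dots> \<le> onorm ((*v) M) * (quad P u / c)"
      by (intro mult_left_mono norm_le onorm_matrix_nonneg)
    finally show ?thesis by (simp add: m_def)
  qed
  define \<delta>' where "\<delta>' = \<delta> / C"
  have \<delta>': "\<delta>' > 0" using \<delta> c by (simp add: \<delta>'_def)
  \<comment> \<open>The \<open>V\<close> part of the error is
    \<open>8 * m * \<theta> * \<beta> * T * T * V\<close>, that is
    \<open>\<theta> * D * V / 2\<close>. Making \<open>\<theta> * D\<close> at most
    \<open>\<delta>'\<close> lets half of the left-hand side absorb it; \<open>\<kappa>\<close>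
    collects the coefficients of \<open>E\<close>.\<close>
  define D where "D = 16 * T\<^sup>2 * m * \<beta>"
  have D: "D \<ge> 0" using m0 \<beta>0 by (simp add: D_def)
  define \<theta> where "\<theta> = \<delta>' / (D + 1)"
  have \<theta>: "\<theta> > 0" using \<delta>' D by (simp add: \<theta>_def)
  have "\<theta> * D \<le> \<theta> * (D + 1)" using \<theta> by simp
  also have "\<dots> = \<delta>'" using D by (simp add: \<theta>_def)
  finally have \<theta>D: "\<theta> * D \<le> \<delta>'" .
  define \<kappa> where "\<kappa> = 2 + T * m / \<theta>"
  have \<kappa>: "\<kappa> > 0" using T m0 \<theta> by (auto simp: \<kappa>_def intro!: add_pos_nonneg)
  \<comment> \<open>The cap at \<open>1 / 2\<close> keeps the contraction factor
    \<open>1 - \<eta>\<close> positive, so that its logarithm can serve as a decay rate.\<close>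
  define \<eta> where "\<eta> = min (1 / 2) (\<delta>' / (2 * \<kappa>))"
  have \<eta>: "\<eta> > 0" "\<eta> \<le> 1 / 2" using \<delta>' \<kappa> by (auto simp: \<eta>_def)
  show thesis
  proof (rule that[of "1 - \<eta>"])
    fix \<alpha> a x
    assume tr: "damped_trajectory A P M B G \<alpha> a (a + T) x" and \<mu>: "\<mu> \<le> integral {a..a + T} \<alpha>"
    interpret damped_trajectory A P M B G \<alpha> a "a + T" x by (rule tr)
    define V where "V = quad P (x a)"
    define E where "E = integral {a..a + T} (\<lambda>s. \<alpha> s * quad M (x s))"
    have V0: "V \<ge> 0" unfolding V_def by (rule pos_def_nonneg[OF P])
    define R where "R = 4 * \<theta> * \<beta> * T * V + E / (2 * \<theta>)"
    have R: "quad P (x s - flow A (x a) (s - a)) \<le> R" if "s \<in> {a..a + T}" for s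
      using distance_to_flow[OF \<theta> \<beta> \<beta>0, of s] that by (simp add: R_def V_def E_def)
    have R0: "R \<ge> 0" using R[of a] T by simp
    have "\<delta>' * V \<le> \<delta>' * (C * (norm (x a))\<^sup>2)"
      unfolding V_def using \<delta>' c(4) by (intro mult_left_mono) auto
    also have "\<dots> = \<delta> * (norm (x a))\<^sup>2" using c(2) by (simp add: \<delta>'_def)
    also have "\<dots> \<le> integral {a..a + T} (\<lambda>s. \<alpha> s * quad M (flow A (x a) (s - a)))"
      by (rule obs[OF \<alpha>_meas \<alpha>_range \<mu>])
    also have "\<dots> \<le> integral {a..a + T} (\<lambda>s. 2 * (\<alpha> s * quad M (x s)) + 2 * (m * R))"
    proof (rule integral_le)
      show "(\<lambda>s. \<alpha> s * quad M (flow A (x a) (s - a))) integrable_on {a..a + T}"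
        by (rule integrable_times_continuous[OF \<alpha>_meas \<alpha>_range continuous_on_quad_flow])
      show "(\<lambda>s. 2 * (\<alpha> s * quad M (x s)) + 2 * (m * R)) integrable_on {a..a + T}"
        by (rule integrable_add[OF integrable_on_mult_right[OF integrable_M] integrable_const_ivl])
      fix s assume s: "s \<in> {a..a + T}"
      then have \<alpha>s: "0 \<le> \<alpha> s" "\<alpha> s \<le> 1" using \<alpha>_range by auto
      define e where "e = x s - flow A (x a) (s - a)"
      have "flow A (x a) (s - a) = x s - e" by (simp add: e_def)
      then have "quad M (flow A (x a) (s - a)) \<le> 2 * quad M (x s) + 2 * quad M e"
        using quad_diff_le[OF M_sym M_nonneg, of "x s" e] by simp
      moreover have "quad M e \<le> m * R"
        using m[of e] mult_left_mono[OF R[OF s] m0] unfolding e_def by linarith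
      ultimately have "quad M (flow A (x a) (s - a)) \<le> 2 * quad M (x s) + 2 * (m * R)" by linarith
      then have "\<alpha> s * quad M (flow A (x a) (s - a)) \<le> \<alpha> s * (2 * quad M (x s) + 2 * (m * R))"
        using \<alpha>s by (intro mult_left_mono) auto
      moreover have "\<alpha> s * (2 * (m * R)) \<le> 2 * (m * R)"
        using \<alpha>s m0 R0 by (intro mult_left_le_one_le) auto
      ultimately show "\<alpha> s * quad M (flow A (x a) (s - a)) \<le> 2 * (\<alpha> s * quad M (x s)) + 2 * (m * R)"
        by (simp add: distrib_left)
    qed
    also have "\<dots> = 2 * E + 2 * (m * R) * T"
      using T by (subst integral_add[OF integrable_on_mult_right[OF integrable_M] integrable_const_ivl]) (simp add: E_def)
    also have "\<dots> = \<kappa> * E + \<theta> * D * V / 2"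
      using \<theta> by (simp add: R_def \<kappa>_def D_def field_simps power2_eq_square)
    also have "\<dots> \<le> \<kappa> * E + \<delta>' * V / 2"
      using mult_right_mono[OF \<theta>D V0] by simp
    finally have "\<delta>' * V / 2 \<le> \<kappa> * E" by simp
    then have "\<delta>' / (2 * \<kappa>) * V \<le> E" using \<kappa> by (simp add: field_simps)
    moreover have "\<eta> * V \<le> \<delta>' / (2 * \<kappa>) * V"
      using V0 by (intro mult_right_mono) (auto simp: \<eta>_def)
    ultimately have "\<eta> * V \<le> E" by linarith
    then show "quad P (x (a + T)) \<le> (1 - \<eta>) * quad P (x a)"
      using storage_decrease by (simp add: V_def E_def algebra_simps)
  qed (use \<eta> in auto)
qed

section \<open>Signals and Caratheodory solutions on windows\<close>

lemma PE_signals_measurable: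
  assumes "\<alpha> \<in> PE_signals T \<mu>" "0 \<le> a"
  shows "\<alpha> \<in> borel_measurable (lebesgue_on {a..b})"
proof (rule measurable_restrict_mono)
  show "\<alpha> \<in> borel_measurable (lebesgue_on {0..})" using assms(1) by (simp add: PE_signals_def)
  show "{a..b} \<subseteq> {0..}" using assms(2) by auto
qed

lemma PE_signals_integral:
  assumes \<alpha>: "\<alpha> \<in> PE_signals T \<mu>" and a: "0 \<le> a"
  shows "\<mu> \<le> integral {a..a + T} \<alpha>"
proof -
  have "\<alpha> absolutely_integrable_on {a..a + T}"
  proof (rule measurable_bounded_by_integrable_imp_absolutely_integrable)
    show "\<alpha> \<in> borel_measurable (lebesgue_on {a..a + T})"
      by (rule PE_signals_measurable[OF assms])
    show "(\<lambda>s. 1 :: real) integrable_on {a..a + T}" by (rule integrable_const_ivl)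
    show "norm (\<alpha> s) \<le> 1" if "s \<in> {a..a + T}" for s
      using \<alpha> a that by (auto simp: PE_signals_def)
  qed simp
  then have "(LINT s:{a..a + T}|lebesgue. \<alpha> s) = integral {a..a + T} \<alpha>"
    by (rule set_lebesgue_integral_eq_integral(2))
  moreover have "\<mu> \<le> (LINT s:{a..a + T}|lebesgue. \<alpha> s)"
    using \<alpha> a unfolding PE_signals_def by blast
  ultimately show ?thesis by simp
qed

text \<open>Absolute integrability identifies the Lebesgue integral of the solution concept with the
  gauge integral of the estimates; additivity then moves the base point from \<open>t0\<close> to
  \<open>a\<close>.\<close>

lemma (in damped_system) trajectory_of_solution:
  assumes sol: "is_solution A B (- G) \<alpha> t0 x0 x" and \<alpha>: "\<alpha> \<in> PE_signals T \<mu>"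
    and t0: "0 \<le> t0" "t0 \<le> a" "a \<le> b"
  shows "damped_trajectory A P M B G \<alpha> a b x"
proof
  have cont: "continuous_on {t0..} x" using sol by (simp add: is_solution_def)
  show "a \<le> b" by fact
  show "\<alpha> \<in> borel_measurable (lebesgue_on {a..b})"
    using PE_signals_measurable[OF \<alpha>] t0 by simp
  show "\<alpha> s \<in> {0..1}" if "s \<in> {a..b}" for s
    using \<alpha> t0 that by (auto simp: PE_signals_def)
  show "continuous_on {a..b} x"
    using t0 by (intro continuous_on_subset[OF cont]) auto
  let ?F = "\<lambda>s. A *v x s - \<alpha> s *\<^sub>R (B *v (G *v x s))"
  have neg: "(- G) *v v = - (G *v v)" for v
    by (simp add: matrix_vector_mult_def Finite_Cartesian_Product.vec_eq_iff sum_negf)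
  have "(A + \<alpha> s *\<^sub>R (B ** (- G))) *v x s = ?F s" for s
    unfolding matrix_vector_mult_add_rdistrib scaleR_matrix_vector_assoc[symmetric] matrix_vector_mul_assoc[symmetric] neg
      linear_neg[OF matrix_vector_mul_linear] by simp
  then have F: "?F absolutely_integrable_on {t0..t}" "x t = x0 + (LINT s:{t0..t}|lebesgue. ?F s)" if "t0 \<le> t" for t
    using sol that by (simp_all add: is_solution_def)
  have Fi: "?F integrable_on {t0..t}" "x t = x0 + integral {t0..t} ?F" if "t0 \<le> t" for t
    using set_lebesgue_integral_eq_integral[OF F(1)[OF that]] F(2)[OF that] by simp_all
  show "x t = x a + integral {a..t} ?F" if "t \<in> {a..b}" for t
  proof -
    have "integral {t0..t} ?F = integral {t0..a} ?F + integral {a..t} ?F"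
      using Henstock_Kurzweil_Integration.integral_combine[where a = t0 and c = a and b = t and f = ?F] Fi(1)[of t] that t0
      by simp
    then show ?thesis using Fi(2)[of t] Fi(2)[of a] that t0 by simp
  qed
qed

lemma exponential_class_KL:
  assumes "D > 0" "\<gamma> > 0"
  shows "(\<lambda>s t. D * exp (- \<gamma> * t) * s) \<in> class_KL"
  unfolding class_KL_def
proof (intro CollectI conjI allI impI)
  fix s :: real assume s: "0 \<le> s"
  show "antimono_on {0..} (\<lambda>t. D * exp (- \<gamma> * t) * s)"
    using assms s by (intro monotone_onI mult_right_mono mult_left_mono) auto
  show "((\<lambda>t. D * exp (- \<gamma> * t) * s) \<longlongrightarrow> 0) at_top"
    using assms by real_asymp
qed (use assms in \<open>auto intro!: continuous_intros strict_mono_onI\<close>)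

text \<open>Full windows after \<open>t0\<close> contract the storage geometrically, and on the
  incomplete last one it does not increase. The resulting bound is exponential in time and linear in
  \<open>norm x0\<close>, with constants common to all signals.\<close>

lemma (in damped_system) is_stabilizer_if_contraction:
  assumes T: "T > 0" and \<rho>: "0 < \<rho>" "\<rho> < 1"
    and contr: "\<And>\<alpha> a x. damped_trajectory A P M B G \<alpha> a (a + T) x \<Longrightarrow> \<mu> \<le> integral {a..a + T} \<alpha> \<Longrightarrow>
      quad P (x (a + T)) \<le> \<rho> * quad P (x a)"
  shows "is_stabilizer T \<mu> A B (- G)"
proof -
  obtain c C where c: "c > 0" "C > 0" "\<And>x. c * (norm x)\<^sup>2 \<le> quad P x" "\<And>x. quad P x \<le> C * (norm x)\<^sup>2"
    by (rule pos_def_bounds[OF P]) (rule that)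
  \<comment> \<open>\<open>1 / \<rho>\<close> pays for the incomplete window. The root here and the
    2 in \<open>\<gamma>\<close> arise because the storage is comparable to the square of the
    norm.\<close>
  define D where "D = sqrt (C / (c * \<rho>))"
  define \<gamma> where "\<gamma> = - ln \<rho> / (2 * T)"
  have D: "D > 0" using c \<rho> by (simp add: D_def)
  have \<gamma>: "\<gamma> > 0" using T \<rho> by (simp add: \<gamma>_def field_simps)
  have decay: "norm (x t) \<le> D * exp (- \<gamma> * (t - t0)) * norm x0"
    if \<alpha>: "\<alpha> \<in> PE_signals T \<mu>" and t0: "0 \<le> t0" and sol: "is_solution A B (- G) \<alpha> t0 x0 x" and t: "t0 \<le> t"
    for \<alpha> x0 t0 x t
  proof -
    note traj = trajectory_of_solution[OF sol \<alpha> t0]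
    \<comment> \<open>The integral over a single point vanishes, so the integral equation at
      \<open>t0\<close> yields the initial value.\<close>
    have x0: "x t0 = x0"
    proof -
      let ?F = "\<lambda>s. (A + \<alpha> s *\<^sub>R (B ** (- G))) *v x s"
      have "?F absolutely_integrable_on {t0..t0}" "x t0 = x0 + (LINT s:{t0..t0}|lebesgue. ?F s)"
        using sol unfolding is_solution_def by blast+
      then show ?thesis by (simp only: set_lebesgue_integral_eq_integral(2)) simp
    qed
    have kT: "t0 \<le> t0 + real k * T" for k using T by simp
    have iter: "quad P (x (t0 + real k * T)) \<le> \<rho> ^ k * quad P x0" for k
    proof (induction k)
      case (Suc k)
      have "quad P (x (t0 + real k * T + T)) \<le> \<rho> * quad P (x (t0 + real k * T))"
        by (rule contr[OF traj PE_signals_integral[OF \<alpha>]]) (use kT[of k] t0 T in auto)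
      also have "\<dots> \<le> \<rho> * (\<rho> ^ k * quad P x0)"
        using Suc \<rho> by (intro mult_left_mono) auto
      finally show ?case by (simp add: algebra_simps)
    qed (simp add: x0)
    define k where "k = nat \<lfloor>(t - t0) / T\<rfloor>"
    have r: "real k = of_int \<lfloor>(t - t0) / T\<rfloor>"
      using t T by (simp add: k_def)
    have k: "real k \<le> (t - t0) / T" "(t - t0) / T < real k + 1"
      unfolding r by linarith+
    have kt: "t0 + real k * T \<le> t" using k(1) T by (simp add: field_simps)
    have V0: "quad P x0 \<ge> 0" by (rule pos_def_nonneg[OF P])
    have "\<rho> ^ k = exp (real k * ln \<rho>)"
      using \<rho> by (simp add: exp_of_nat_mult)
    \<comment> \<open>Here \<open>ln \<rho>\<close> is negative, so the lower bound
      \<open>(t - t0) / T - 1\<close> on \<open>k\<close> becomes an upper bound on the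
      power.\<close>
    also have "\<dots> \<le> exp (((t - t0) / T - 1) * ln \<rho>)"
      using k(2) \<rho> by (simp add: mult_right_mono_neg)
    also have "((t - t0) / T - 1) * ln \<rho> = 2 * (- \<gamma> * (t - t0)) - ln \<rho>"
      using T by (simp add: \<gamma>_def field_simps)
    also have "exp \<dots> = (exp (- \<gamma> * (t - t0)))\<^sup>2 / \<rho>"
      unfolding exp_diff exp_double using \<rho> by simp
    finally have \<rho>k: "\<rho> ^ k \<le> (exp (- \<gamma> * (t - t0)))\<^sup>2 / \<rho>" .
    have "c * (norm (x t))\<^sup>2 \<le> quad P (x t)" by (rule c)
    also have "\<dots> \<le> quad P (x (t0 + real k * T))"
      by (rule damped_trajectory.storage_le[OF traj[OF kT kt] kt order_refl])
    also have "\<dots> \<le> \<rho> ^ k * quad P x0" by (rule iter)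
    also have "\<dots> \<le> (exp (- \<gamma> * (t - t0)))\<^sup>2 / \<rho> * (C * (norm x0)\<^sup>2)"
      using \<rho> by (intro mult_mono \<rho>k c(4) V0) auto
    finally have "(norm (x t))\<^sup>2 \<le> (exp (- \<gamma> * (t - t0)))\<^sup>2 / \<rho> * (C * (norm x0)\<^sup>2) / c"
      using c(1) by (simp only: pos_le_divide_eq mult.commute)
    also have "\<dots> = C / (c * \<rho>) * (exp (- \<gamma> * (t - t0)))\<^sup>2 * (norm x0)\<^sup>2"
      by (simp add: mult_ac)
    also have "\<dots> = (D * exp (- \<gamma> * (t - t0)) * norm x0)\<^sup>2"
      using c \<rho> by (simp add: D_def power_mult_distrib)
    finally show ?thesis
      by (rule power2_le_imp_le) (use D in simp)
  qed
  show ?thesis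
    unfolding is_stabilizer_def
    by (intro bexI[OF _ exponential_class_KL[OF D \<gamma>]] ballI allI impI) (rule decay)
qed

theorem theorem7:
  fixes A :: "real ^ 'n ^ 'n" and B :: "real ^ 'm ^ 'n"
  assumes "stabilizable A B" and "neutrally_stable A"
  shows "\<exists>K :: real ^ 'n ^ 'm. \<forall>T \<mu>. 0 < \<mu> \<and> \<mu> \<le> T \<longrightarrow> is_stabilizer T \<mu> A B K"
proof -
  obtain P where P: "pos_def P" and diss: "\<And>x. inner x (P *v (A *v x)) \<le> 0"
    by (rule neutrally_stable_lyapunov[OF assms(2)]) (rule that)
  define G where "G = transpose B ** P"
  define M where "M = dissipation A B P"
  have G: "G *v x = transpose B *v (P *v x)" for x
    unfolding G_def by (rule matrix_vector_mul_assoc[symmetric])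
  interpret damped_system A P M B G
  proof
    show "inner u (P *v (B *v v)) = inner (G *v u) v" for u v
    proof -
      have "inner u (P *v (B *v v)) = inner (P *v u) (B *v v)"
        by (subst pos_def_sym[OF P]) (rule inner_commute)
      then show ?thesis unfolding G by (simp only: inner_matrix_vector_transpose)
    qed
    show "inner x (M *v y) = inner y (M *v x)" for x y
      unfolding M_def by (rule dissipation_properties(1)[OF P diss])
    show "quad M x = 2 * (norm (G *v x))\<^sup>2 - 2 * inner x (P *v (A *v x))" for x
      unfolding M_def G by (rule dissipation_properties(2)[OF P diss])
  qed (fact P diss)+
  \<comment> \<open>\<open>P\<close> and \<open>G\<close> are already fixed; only
    \<open>\<delta>\<close> and \<open>\<rho>\<close> depend on \<open>T\<close> and
    \<open>\<mu>\<close>.\<close>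
  have "is_stabilizer T \<mu> A B (- G)" if \<mu>: "0 < \<mu>" "\<mu> \<le> T" for T \<mu>
  proof -
    have T: "T > 0" using \<mu> by simp
    show ?thesis
    proof (rule uniform_observability[where A = A and M = M and \<mu> = \<mu> and T = T])
      show "x = 0" if "\<And>t. t \<ge> 0 \<Longrightarrow> M *v flow A x t = 0" for x
        using flow_observable[OF assms(1) P diss] that unfolding M_def by blast
      fix \<delta> :: real
      assume "\<delta> > 0" and obs: "\<And>a \<alpha> v. \<alpha> \<in> borel_measurable (lebesgue_on {a..a + T}) \<Longrightarrow>
        (\<And>s. s \<in> {a..a + T} \<Longrightarrow> \<alpha> s \<in> {0..1}) \<Longrightarrow> \<mu> \<le> integral {a..a + T} \<alpha> \<Longrightarrow>
        \<delta> * (norm v)\<^sup>2 \<le> integral {a..a + T} (\<lambda>s. \<alpha> s * quad M (flow A v (s - a)))"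
      show ?thesis
      proof (rule window_contraction[OF T \<open>\<delta> > 0\<close>])
        fix \<rho> :: real
        assume \<rho>: "0 < \<rho>" "\<rho> < 1" and contr: "\<And>\<alpha> a x. damped_trajectory A P M B G \<alpha> a (a + T) x \<Longrightarrow>
          \<mu> \<le> integral {a..a + T} \<alpha> \<Longrightarrow> quad P (x (a + T)) \<le> \<rho> * quad P (x a)"
        show ?thesis by (rule is_stabilizer_if_contraction[OF T \<rho>]) (rule contr)
      qed (rule obs)
    qed (fact M_sym M_nonneg \<mu>)+
  qed
  then show ?thesis by blast
qed

end
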